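(* Let $q$ be an odd prime power and let $G$ be one of $\mathrm{GL}(2,q)$, $\mathrm{GU}(2,q)$, or $\mathrm{SL}(2,q)$. Then there exists an inverse-closed subset $\mathfrak{S}\subseteq G\setminus\{1\}$ which is a union of conjugacy classes of $G$ such that the Cayley graph $\Gamma=\mathrm{Cay}(G,\mathfrak{S})$ is connected, admits perfect state transfer, and its complement $\overline{\Gamma}$ is not a disjoint union of copies of $K_2$.
   Context: For a finite group $G$ and an inverse-closed subset $\mathfrak{S}\subseteq G\setminus\{1\}$, the Cayley graph $\mathrm{Cay}(G,\mathfrak{S})$ has vertex set $G$, with $g$ adjacent to $h$ iff $hg^{-1}\in\mathfrak{S}$; it is called a normal Cayley graph when $\mathfrak{S}$ is a union of conjugacy classes. $\mathrm{GU}(2,q)$ is the subgroup of $\mathrm{GL}(2,q^2)$ preserving a fixed nondegenerate hermitian form on $\mathbb{F}_{q^2}^2$. For a simple graph $X$ with adjacency matrix $A$, set $U(\tau)=\exp(-i\tau A)$ for $\tau\in\mathbb{R}$. There is perfect state transfer (PST) from vertex $a$ to vertex $b\neq a$ at time $\tau$ if $U(\tau)e_a=\gamma e_b$ for some $\gamma\in\mathbb{C}$ with $|\gamma|=1$, where $e_v$ denotes the standard basis vector of $\mathbb{C}^{V(X)}$ indexed by $v$. A graph admits PST if PST occurs between some pair of vertices at some time. *)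

theory Defs
  imports
    "HOL-Analysis.Analysis"
    "HOL-Algebra.Group"
    "HOL-Number_Theory.Prime_Powers"
    "Graph_Theory.Kuratowski"
begin

section \<open>The groups\<close>

definition GL2 :: "('a::field^2^2) monoid" where
  "GL2 = \<lparr>carrier = {A. invertible A}, mult = (**), one = mat 1\<rparr>"

definition SL2 :: "('a::field^2^2) monoid" where
  "SL2 = \<lparr>carrier = {A. det A = 1}, mult = (**), one = mat 1\<rparr>"

text \<open>
  Hermitian forms are meant for a field with \<open>q\<^sup>2\<close> elements, where \<open>x \<mapsto> x ^ q\<close> is the
  field automorphism of order 2.  Forms are linear in the first argument, hence semilinear
  in the second.
\<close>

definition hermitian_form :: "nat \<Rightarrow> ('a::field^2 \<Rightarrow> 'a^2 \<Rightarrow> 'a) \<Rightarrow> bool" where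
  "hermitian_form q B \<longleftrightarrow>
     (\<forall>u v w. B (u + v) w = B u w + B v w) \<and>
     (\<forall>c u v. B (c *s u) v = c * B u v) \<and>
     (\<forall>u v. B v u = B u v ^ q)"

definition nondegenerate_form :: "('a::field^2 \<Rightarrow> 'a^2 \<Rightarrow> 'a) \<Rightarrow> bool" where
  "nondegenerate_form B \<longleftrightarrow> (\<forall>u. (\<forall>v. B u v = 0) \<longrightarrow> u = 0)"

definition GU2 :: "('a::field^2 \<Rightarrow> 'a^2 \<Rightarrow> 'a) \<Rightarrow> ('a^2^2) monoid" where
  "GU2 B = \<lparr>carrier = {A. invertible A \<and> (\<forall>u v. B (A *v u) (A *v v) = B u v)},
            mult = (**), one = mat 1\<rparr>"

lemma invertible_mat_one: "invertible (mat 1 :: 'a::field^2^2)"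
  by (simp add: invertible_det_nz)

lemma group_GL2: "group GL2"
proof (rule groupI)
  fix A :: "'a^2^2" assume "A \<in> carrier GL2"
  then obtain A' where "A ** A' = mat 1" "A' ** A = mat 1"
    by (auto simp: GL2_def invertible_def)
  then show "\<exists>B\<in>carrier GL2. B \<otimes>\<^bsub>GL2\<^esub> A = \<one>\<^bsub>GL2\<^esub>"
    by (auto simp: GL2_def invertible_def)
qed (auto simp: GL2_def matrix_mul_assoc invertible_mult invertible_mat_one)

lemma subgroup_SL2: "subgroup (carrier SL2) GL2"
proof -
  interpret group "GL2 :: ('a^2^2) monoid" by (rule group_GL2)
  show ?thesis
  proof
    fix A :: "'a^2^2" assume A: "A \<in> carrier SL2"
    then have inA: "A \<in> carrier GL2"
      by (simp add: SL2_def GL2_def invertible_det_nz)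
    have "det A * det (inv\<^bsub>GL2\<^esub> A) = det (A \<otimes>\<^bsub>GL2\<^esub> inv\<^bsub>GL2\<^esub> A)"
      by (simp add: det_mul GL2_def)
    also have "\<dots> = 1"
      using r_inv[OF inA] by (simp add: GL2_def)
    finally show "inv\<^bsub>GL2\<^esub> A \<in> carrier SL2"
      using A by (simp add: SL2_def)
  qed (auto simp: GL2_def SL2_def invertible_det_nz det_mul)
qed

lemma subgroup_GU2: "subgroup (carrier (GU2 B)) GL2"
proof -
  interpret group "GL2 :: ('a^2^2) monoid" by (rule group_GL2)
  show ?thesis
  proof
    fix A :: "'a^2^2" assume A: "A \<in> carrier (GU2 B)"
    then have inA: "A \<in> carrier GL2"
      by (simp add: GU2_def GL2_def)
    let ?A' = "inv\<^bsub>GL2\<^esub> A"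
    have inv: "invertible ?A'" using inv_closed[OF inA] by (simp add: GL2_def)
    have eq: "A ** ?A' = mat 1" using r_inv[OF inA] by (simp add: GL2_def)
    have "B (?A' *v u) (?A' *v v) = B u v" for u v
    proof -
      have "B (?A' *v u) (?A' *v v) = B (A *v (?A' *v u)) (A *v (?A' *v v))"
        using A by (simp add: GU2_def)
      then show ?thesis by (simp add: matrix_vector_mul_assoc eq)
    qed
    with inv show "?A' \<in> carrier (GU2 B)" by (simp add: GU2_def)
  qed (auto simp: GL2_def GU2_def invertible_mult invertible_mat_one
        matrix_vector_mul_assoc[symmetric])
qed

lemma group_SL2: "group SL2"
  using group.subgroup_imp_group[OF group_GL2 subgroup_SL2]
  by (simp add: SL2_def GL2_def)

lemma group_GU2: "group (GU2 B)"
  using group.subgroup_imp_group[OF group_GL2 subgroup_GU2[of B]]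
  by (simp add: GU2_def GL2_def)

definition conjugacy_class :: "('g, 'm) monoid_scheme \<Rightarrow> 'g \<Rightarrow> 'g set" where
  "conjugacy_class G x = (\<lambda>g. g \<otimes>\<^bsub>G\<^esub> x \<otimes>\<^bsub>G\<^esub> inv\<^bsub>G\<^esub> g) ` carrier G"

definition union_of_conjugacy_classes :: "('g, 'm) monoid_scheme \<Rightarrow> 'g set \<Rightarrow> bool" where
  "union_of_conjugacy_classes G S \<longleftrightarrow> (\<exists>X \<subseteq> carrier G. S = (\<Union>x\<in>X. conjugacy_class G x))"

definition inverse_closed :: "('g, 'm) monoid_scheme \<Rightarrow> 'g set \<Rightarrow> bool" where
  "inverse_closed G S \<longleftrightarrow> (\<forall>s\<in>S. inv\<^bsub>G\<^esub> s \<in> S)"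

section \<open>Graphs\<close>

text \<open>
  A simple graph is a digraph satisfying the locale \<open>pair_graph\<close>: finite, loopless and with
  a symmetric set of arcs.
\<close>

definition Cayley_graph :: "('g, 'm) monoid_scheme \<Rightarrow> 'g set \<Rightarrow> 'g pair_pre_digraph" where
  "Cayley_graph G S = \<lparr>pverts = carrier G,
     parcs = {(g, h). g \<in> carrier G \<and> h \<in> carrier G \<and> h \<otimes>\<^bsub>G\<^esub> inv\<^bsub>G\<^esub> g \<in> S}\<rparr>"

lemma pair_graph_Cayley_graph:
  assumes "group G" "finite (carrier G)" "S \<subseteq> carrier G - {\<one>\<^bsub>G\<^esub>}" "inverse_closed G S"
  shows "pair_graph (Cayley_graph G S)"
proof -
  interpret group G by fact
  let ?X = "Cayley_graph G S"
  have sub: "parcs ?X \<subseteq> carrier G \<times> carrier G"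
    by (auto simp: Cayley_graph_def)
  have "(h, g) \<in> parcs ?X" if "(g, h) \<in> parcs ?X" for g h
  proof -
    from that have gh: "g \<in> carrier G" "h \<in> carrier G" and "h \<otimes>\<^bsub>G\<^esub> inv\<^bsub>G\<^esub> g \<in> S"
      by (auto simp: Cayley_graph_def)
    then have "inv\<^bsub>G\<^esub> (h \<otimes>\<^bsub>G\<^esub> inv\<^bsub>G\<^esub> g) \<in> S"
      using assms(4) by (auto simp: inverse_closed_def)
    with gh show ?thesis
      by (simp add: Cayley_graph_def inv_mult_group)
  qed
  then have "sym (parcs ?X)" by (rule symI)
  moreover have "finite (parcs ?X)"
    using sub assms(2) by (meson finite_SigmaI finite_subset)
  moreover have "fst e \<noteq> snd e" if "e \<in> parcs ?X" for e
    using that assms(3) by (auto simp: Cayley_graph_def)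
  ultimately show ?thesis
    using sub assms(2)
    by unfold_locales (auto simp: Cayley_graph_def symmetric_def)
qed

definition graph_complement :: "'v pair_pre_digraph \<Rightarrow> 'v pair_pre_digraph" where
  "graph_complement X = \<lparr>pverts = pverts X,
     parcs = {(u, v). u \<in> pverts X \<and> v \<in> pverts X \<and> u \<noteq> v \<and> (u, v) \<notin> parcs X}\<rparr>"

definition disjoint_union_of_K2 :: "'v pair_pre_digraph \<Rightarrow> bool" where
  "disjoint_union_of_K2 X \<longleftrightarrow>
     (\<exists>\<H> :: 'v pair_pre_digraph set.
        (\<forall>H\<in>\<H>. complete_digraph 2 (with_proj H)) \<and>
        pairwise (\<lambda>H H'. disjnt (pverts H) (pverts H')) \<H> \<and>
        pverts X = (\<Union>H\<in>\<H>. pverts H) \<and>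
        parcs X = (\<Union>H\<in>\<H>. parcs H))"

section \<open>Perfect state transfer\<close>

text \<open>
  A square matrix with rows and columns indexed by the finite set \<open>V\<close> is a function of two
  arguments; only its values on \<open>V \<times> V\<close> matter.  Similarly, vectors in \<open>\<complex>\<^sup>V\<close> are functions.
\<close>

primrec mat_pow_on :: "'v set \<Rightarrow> ('v \<Rightarrow> 'v \<Rightarrow> complex) \<Rightarrow> nat \<Rightarrow> 'v \<Rightarrow> 'v \<Rightarrow> complex" where
  "mat_pow_on V M 0 = (\<lambda>u v. if u = v then 1 else 0)"
| "mat_pow_on V M (Suc k) = (\<lambda>u v. \<Sum>w\<in>V. M u w * mat_pow_on V M k w v)"

definition mat_exp_on :: "'v set \<Rightarrow> ('v \<Rightarrow> 'v \<Rightarrow> complex) \<Rightarrow> 'v \<Rightarrow> 'v \<Rightarrow> complex" where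
  "mat_exp_on V M u v = (\<Sum>k. mat_pow_on V M k u v / fact k)"

definition mat_vec_on :: "'v set \<Rightarrow> ('v \<Rightarrow> 'v \<Rightarrow> complex) \<Rightarrow> ('v \<Rightarrow> complex) \<Rightarrow> 'v \<Rightarrow> complex" where
  "mat_vec_on V M x u = (\<Sum>v\<in>V. M u v * x v)"

definition std_basis :: "'v \<Rightarrow> 'v \<Rightarrow> complex" where
  "std_basis a v = (if v = a then 1 else 0)"

definition adjacency_matrix :: "'v pair_pre_digraph \<Rightarrow> 'v \<Rightarrow> 'v \<Rightarrow> complex" where
  "adjacency_matrix X u v = (if (u, v) \<in> parcs X then 1 else 0)"

definition transition_matrix :: "'v pair_pre_digraph \<Rightarrow> real \<Rightarrow> 'v \<Rightarrow> 'v \<Rightarrow> complex" where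
  "transition_matrix X \<tau> =
     mat_exp_on (pverts X) (\<lambda>u v. - \<i> * of_real \<tau> * adjacency_matrix X u v)"

definition perfect_state_transfer :: "'v pair_pre_digraph \<Rightarrow> real \<Rightarrow> 'v \<Rightarrow> 'v \<Rightarrow> bool" where
  "perfect_state_transfer X \<tau> a b \<longleftrightarrow>
     a \<in> pverts X \<and> b \<in> pverts X \<and> a \<noteq> b \<and>
     (\<exists>\<gamma>::complex. norm \<gamma> = 1 \<and>
        (\<forall>v\<in>pverts X. mat_vec_on (pverts X) (transition_matrix X \<tau>) (std_basis a) v
                         = \<gamma> * std_basis b v))"

definition admits_PST :: "'v pair_pre_digraph \<Rightarrow> bool" where
  "admits_PST X \<longleftrightarrow> (\<exists>\<tau> a b. perfect_state_transfer X \<tau> a b)"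

end

(*
  Let z = -1. If a graph has S = insert z T with z T = T, then delta_1 - delta_z is an eigenvector with
  eigenvalue -1. If moreover delta_1 + delta_z is a sum of eigenvectors with eigenvalues congruent
  to 1 modulo 4, then at time pi/2 the two parts are multiplied by i and -i, and delta_1 is sent
  to -i delta_z.

  For GL(2,q) and GU(2,q), T is the complement of the subgroup N of elements of determinant 1.
  The eigenvalues of T are 0, -|N| and |G| - |N|, and 4 divides |N| because N contains an element
  J with J^2 = -1 and hence of order 4.

  For SL(2,q), T consists of the elements u and -u with u a nontrivial unipotent. On even
  functions T acts as twice the class sum of the unipotents, whose relevant eigenvalues q^2 - 1,
  0, q - 1 and -(q + 1) are all even. They are found by summing over transvections, that is over
  pairs of a line and a nonzero scalar.
*)
theory Submission
  imports Defs "HOL-Algebra.Generated_Groups" "HOL-Algebra.Multiplicative_Group" "HOL-Number_Theory.Residues"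
begin

text \<open>SL(2,q) needs its own connection set: the determinant is trivial there, and for q > 3
  its proper normal subgroups are central of order at most 2, so none of order divisible by 4 is
  available. Pairing each unipotent u with -u doubles the eigenvalues on even functions, so that
  their being even is enough. Odd q enters twice: it separates -1 from 1, and it makes q^2 - 1, q -
  1 and q + 1 even.

  The full spectrum is never determined. Only delta_1 + delta_z has to be decomposed, and it lies in
  a small space invariant under T: the span of itself, the indicator of N and 1 in the first case,
  and a span of four functions for SL(2,q).

  For GU(2,q) the hermitian form is arbitrary, so the work lies in exhibiting J. An orthogonal basis
  makes the form diagonal with entries a, b; a map exchanging the axes preserves it if it rescales
  by some c with c^(q+1) = a/b, and such a c exists because the norm map is onto the fixed field of
  the power q.\<close>

section \<open>Perfect state transfer from eigenvectors\<close>

text \<open>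
  \<open>evolves V M x y\<close> says \<open>exp M x = y\<close> with the power series applied to \<open>x\<close>, so that for
  combinations of eigenvectors no convergence of the matrix entries has to be established.
\<close>

definition evolves ::
  "'v set \<Rightarrow> ('v \<Rightarrow> 'v \<Rightarrow> complex) \<Rightarrow> ('v \<Rightarrow> complex) \<Rightarrow> ('v \<Rightarrow> complex) \<Rightarrow> bool" where
  "evolves V M x y \<longleftrightarrow> (\<forall>u\<in>V. (\<lambda>k. mat_vec_on V (mat_pow_on V M k) x u / fact k) sums y u)"

lemma evolves_cong:
  assumes "evolves V M x y" "\<And>u. u \<in> V \<Longrightarrow> x u = x' u" "\<And>u. u \<in> V \<Longrightarrow> y u = y' u"
  shows "evolves V M x' y'"
proof -
  have "mat_vec_on V (mat_pow_on V M k) x' u = mat_vec_on V (mat_pow_on V M k) x u" for k u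
    unfolding mat_vec_on_def by (rule sum.cong) (simp_all add: assms(2))
  then show ?thesis using assms(1,3) by (simp add: evolves_def)
qed

lemma evolves_add:
  assumes "evolves V M x y" "evolves V M x' y'"
  shows "evolves V M (\<lambda>u. x u + x' u) (\<lambda>u. y u + y' u)"
  using assms by (auto simp: evolves_def mat_vec_on_def distrib_left sum.distrib add_divide_distrib
      intro!: sums_add)

lemma evolves_cmult:
  assumes "evolves V M x y"
  shows "evolves V M (\<lambda>u. c * x u) (\<lambda>u. c * y u)"
proof -
  have *: "mat_vec_on V (mat_pow_on V M k) (\<lambda>u. c * x u) u / fact k
      = c * (mat_vec_on V (mat_pow_on V M k) x u / fact k)" for k u
    by (simp add: mat_vec_on_def sum_distrib_left mult.left_commute)
  show ?thesis unfolding evolves_def *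
  proof
    fix u assume "u \<in> V"
    then show "(\<lambda>k. c * (mat_vec_on V (mat_pow_on V M k) x u / fact k)) sums (c * y u)"
      using assms unfolding evolves_def by (intro sums_mult) blast
  qed
qed

lemma evolves_eigenvector:
  assumes fin: "finite V" and eig: "\<And>u. u \<in> V \<Longrightarrow> mat_vec_on V M x u = \<mu> * x u"
  shows "evolves V M x (\<lambda>u. exp \<mu> * x u)"
proof -
  have pow: "mat_vec_on V (mat_pow_on V M k) x u = \<mu> ^ k * x u" if "u \<in> V" for k u
    using that
  proof (induction k arbitrary: u)
    case 0
    then show ?case using fin
      by (subst mat_vec_on_def, subst sum.remove[OF fin 0]) (auto intro!: sum.neutral split: if_splits)
  next
    case (Suc k)
    have "mat_vec_on V (mat_pow_on V M (Suc k)) x u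
        = (\<Sum>v\<in>V. \<Sum>w\<in>V. M u w * (mat_pow_on V M k w v * x v))"
      by (simp add: mat_vec_on_def sum_distrib_right mult.assoc)
    also have "\<dots> = (\<Sum>w\<in>V. M u w * mat_vec_on V (mat_pow_on V M k) x w)"
      by (subst sum.swap) (simp add: mat_vec_on_def sum_distrib_left)
    also have "\<dots> = (\<Sum>w\<in>V. \<mu> ^ k * (M u w * x w))"
      by (rule sum.cong) (simp_all add: Suc.IH mult.left_commute)
    also have "\<dots> = \<mu> ^ k * mat_vec_on V M x u"
      by (simp add: mat_vec_on_def sum_distrib_left)
    also have "\<dots> = \<mu> ^ Suc k * x u" using eig[OF Suc.prems] by simp
    finally show ?case .
  qed
  have "(\<lambda>k. \<mu> ^ k / fact k * x u) sums (exp \<mu> * x u)" for u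
    using exp_converges[of \<mu>] by (intro sums_mult2) (simp add: scaleR_conv_of_real field_simps)
  then show ?thesis by (simp add: evolves_def pow)
qed

text \<open>The bridge to \<open>mat_exp_on\<close>, whose entries are infinite sums. Applied to
  \<open>std_basis a\<close>, the series in \<open>evolves\<close> is the entry series of column
  \<open>a\<close>, so its convergence is already part of the hypothesis.\<close>

lemma evolves_std_basis:
  assumes "finite V" "a \<in> V" "u \<in> V" "evolves V M (std_basis a) y"
  shows "mat_vec_on V (mat_exp_on V M) (std_basis a) u = y u"
proof -
  have *: "mat_vec_on V N (std_basis a) u = N u a" for N
    by (subst mat_vec_on_def, subst sum.remove[OF assms(1,2)])
      (auto simp: std_basis_def intro!: sum.neutral split: if_splits)
  show ?thesis using assms(3,4) by (auto simp: evolves_def * mat_exp_on_def sums_iff)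
qed

lemma exp_quarter_turn: "exp (- \<i> * of_real (pi / 2) * (4 * of_int k + 1)) = - \<i>"
proof -
  have "- \<i> * of_real (pi / 2) * (4 * of_int k + 1)
      = 2 * of_int (- k) * of_real pi * \<i> + (- (\<i> * of_real (pi / 2)))"
    by (simp add: field_simps)
  also have "exp \<dots> = exp (- (\<i> * of_real (pi / 2)))"
    unfolding exp_add using exp_integer_2pi[of "of_int (- k)"] by (simp add: mult.assoc)
  also have "\<dots> = - \<i>"
    using cis_minus_pi_half by (simp add: cis_conv_exp)
  finally show ?thesis .
qed

text \<open>Evolution for time \<open>\<pi>/2\<close> multiplies eigenvectors with eigenvalue \<open>\<equiv> 1 (mod 4)\<close> by \<open>-\<i>\<close>.\<close>

definition quarter_phase :: "'v pair_pre_digraph \<Rightarrow> ('v \<Rightarrow> complex) \<Rightarrow> bool" where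
  "quarter_phase X x \<longleftrightarrow>
     evolves (pverts X) (\<lambda>u v. - \<i> * of_real (pi / 2) * adjacency_matrix X u v)
       x (\<lambda>u. - \<i> * x u)"

lemma quarter_phase_add:
  "quarter_phase X x \<Longrightarrow> quarter_phase X y \<Longrightarrow> quarter_phase X (\<lambda>u. x u + y u)"
  unfolding quarter_phase_def by (drule (1) evolves_add) (simp add: distrib_left)

lemma quarter_phase_cmult:
  "quarter_phase X x \<Longrightarrow> quarter_phase X (\<lambda>u. c * x u)"
  unfolding quarter_phase_def by (drule evolves_cmult) (simp add: mult.left_commute)

lemma quarter_phase_cong:
  assumes "quarter_phase X x" "\<And>u. u \<in> pverts X \<Longrightarrow> x u = x' u"
  shows "quarter_phase X x'"
  using assms unfolding quarter_phase_def by (elim evolves_cong) simp_all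

lemma mat_vec_on_scale: "mat_vec_on V (\<lambda>u v. c * M u v) x u = c * mat_vec_on V M x u"
  by (simp add: mat_vec_on_def sum_distrib_left mult.assoc)

lemma quarter_phase_eigenvector:
  assumes "finite (pverts X)"
    and "\<And>u. u \<in> pverts X \<Longrightarrow>
      mat_vec_on (pverts X) (adjacency_matrix X) x u = (4 * of_int k + 1) * x u"
  shows "quarter_phase X x"
proof -
  let ?M = "\<lambda>u v. - \<i> * of_real (pi / 2) * adjacency_matrix X u v"
  have "evolves (pverts X) ?M x (\<lambda>u. exp (- \<i> * of_real (pi / 2) * (4 * of_int k + 1)) * x u)"
  proof (rule evolves_eigenvector[OF assms(1)])
    show "mat_vec_on (pverts X) ?M x u = - \<i> * of_real (pi / 2) * (4 * of_int k + 1) * x u"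
      if "u \<in> pverts X" for u
      unfolding mat_vec_on_scale assms(2)[OF that] by (rule mult.assoc[symmetric])
  qed
  then show ?thesis by (simp only: exp_quarter_turn quarter_phase_def)
qed

lemma admits_PST_if_quarter_phase:
  assumes fin: "finite (pverts X)" and ab: "a \<in> pverts X" "b \<in> pverts X" "a \<noteq> b"
    and even: "quarter_phase X (\<lambda>u. std_basis a u + std_basis b u)"
    and odd: "\<And>u. u \<in> pverts X \<Longrightarrow>
      mat_vec_on (pverts X) (adjacency_matrix X) (\<lambda>u. std_basis a u - std_basis b u) u
        = - (std_basis a u - std_basis b u)"
  shows "admits_PST X"
proof -
  let ?V = "pverts X" and ?M = "\<lambda>u v. - \<i> * of_real (pi / 2) * adjacency_matrix X u v"
  let ?f = "\<lambda>u. std_basis a u - std_basis b u"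
  let ?e = "\<lambda>u. std_basis a u + std_basis b u"
  have "evolves ?V ?M ?f (\<lambda>u. exp (\<i> * of_real (pi / 2)) * ?f u)"
  proof (rule evolves_eigenvector[OF fin])
    show "mat_vec_on ?V ?M ?f u = \<i> * of_real (pi / 2) * ?f u" if "u \<in> ?V" for u
      unfolding mat_vec_on_scale odd[OF that] by (simp only: mult_minus_left mult_minus_right minus_minus)
  qed
  then have f: "evolves ?V ?M ?f (\<lambda>u. \<i> * ?f u)"
    using cis_pi_half by (simp add: cis_conv_exp)
  have "evolves ?V ?M (\<lambda>u. (1/2) * (?e u + ?f u)) (\<lambda>u. (1/2) * (- \<i> * ?e u + \<i> * ?f u))"
    using even f by (intro evolves_cmult evolves_add) (simp_all add: quarter_phase_def)
  then have "evolves ?V ?M (std_basis a) (\<lambda>u. - \<i> * std_basis b u)"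
    by (rule evolves_cong) (simp_all add: field_simps)
  then have "perfect_state_transfer X (pi / 2) a b"
    using fin ab unfolding perfect_state_transfer_def transition_matrix_def
    by (intro conjI exI[of _ "- \<i>"] ballI evolves_std_basis) simp_all
  then show ?thesis unfolding admits_PST_def by blast
qed

section \<open>Cayley graphs: adjacency as a sum over left translations\<close>

context group
begin

lemma mat_vec_on_Cayley_graph:
  assumes "finite (carrier G)" "S \<subseteq> carrier G" "u \<in> carrier G"
  shows "mat_vec_on (carrier G) (adjacency_matrix (Cayley_graph G S)) x u = (\<Sum>s\<in>S. x (s \<otimes> u))"
proof -
  have "mat_vec_on (carrier G) (adjacency_matrix (Cayley_graph G S)) x u
      = (\<Sum>v\<in>{v\<in>carrier G. v \<otimes> inv u \<in> S}. x v)"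
    using assms by (auto simp: mat_vec_on_def adjacency_matrix_def Cayley_graph_def
        intro!: sum.mono_neutral_cong_right split: if_splits)
  also have "\<dots> = (\<Sum>s\<in>S. x (s \<otimes> u))"
    by (rule sum.reindex_bij_witness[of _ "\<lambda>s. s \<otimes> u" "\<lambda>v. v \<otimes> inv u"])
      (use assms in \<open>auto simp: m_assoc subset_iff\<close>)
  finally show ?thesis .
qed

lemma pverts_Cayley_graph [simp]: "pverts (Cayley_graph G S) = carrier G"
  by (simp add: Cayley_graph_def)

text \<open>On functions invariant under \<open>z\<close>, the element \<open>z\<close> contributes
  exactly the 1 in \<open>4 k + 1\<close>; what remains to be checked is that the eigenvalue of
  \<open>T\<close> is divisible by 4.\<close>

lemma quarter_phase_Cayley_eigenvector:
  assumes fin: "finite (carrier G)" and z: "z \<in> carrier G" "z \<notin> T" and T: "T \<subseteq> carrier G"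
    and even: "\<And>u. u \<in> carrier G \<Longrightarrow> x (z \<otimes> u) = x u"
    and eig: "\<And>u. u \<in> carrier G \<Longrightarrow> (\<Sum>s\<in>T. x (s \<otimes> u)) = 4 * of_int k * x u"
  shows "quarter_phase (Cayley_graph G (insert z T)) x"
proof (rule quarter_phase_eigenvector[where k = k])
  fix u assume "u \<in> pverts (Cayley_graph G (insert z T))"
  then have u: "u \<in> carrier G" by simp
  have "mat_vec_on (carrier G) (adjacency_matrix (Cayley_graph G (insert z T))) x u
      = (\<Sum>s\<in>insert z T. x (s \<otimes> u))"
    using assms u by (intro mat_vec_on_Cayley_graph) auto
  also have "\<dots> = x (z \<otimes> u) + (\<Sum>s\<in>T. x (s \<otimes> u))"
    using z finite_subset[OF T fin] by simp
  also have "\<dots> = (4 * of_int k + 1) * x u"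
    unfolding even[OF u] eig[OF u] by (simp add: distrib_right)
  finally show "mat_vec_on (pverts (Cayley_graph G (insert z T)))
      (adjacency_matrix (Cayley_graph G (insert z T))) x u = (4 * of_int k + 1) * x u"
    by simp
qed (simp add: fin)

lemma sum_std_basis_translates:
  assumes "finite (carrier G)" "T \<subseteq> carrier G" "a \<in> carrier G" "u \<in> carrier G"
  shows "(\<Sum>s\<in>T. std_basis a (s \<otimes> u)) = of_bool (a \<otimes> inv u \<in> T)"
proof -
  have "s \<otimes> u = a \<longleftrightarrow> s = a \<otimes> inv u" if "s \<in> T" for s
    using that assms by (auto simp: m_assoc subset_iff)
  then have "(\<Sum>s\<in>T. std_basis a (s \<otimes> u)) = (\<Sum>s\<in>T. if s = a \<otimes> inv u then 1 else 0)"
    by (intro sum.cong) (auto simp: std_basis_def)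
  then show ?thesis using finite_subset[OF assms(2,1)] by (simp add: of_bool_def)
qed

text \<open>Summed over \<open>T\<close>, the two basis vectors become the indicators of
  \<open>inv u \<in> T\<close> and \<open>z \<otimes> inv u \<in> T\<close>, which agree because
  \<open>z\<close> maps \<open>T\<close> to itself. So \<open>T\<close> annihilates the difference,
  and \<open>z\<close> alone, exchanging the two points, gives eigenvalue -1.\<close>

lemma admits_PST_Cayley_graph:
  assumes fin: "finite (carrier G)" and z: "z \<in> carrier G" "z \<noteq> \<one>" "z \<otimes> z = \<one>" "z \<notin> T"
    and T: "T \<subseteq> carrier G" "\<And>s. s \<in> T \<Longrightarrow> z \<otimes> s \<in> T"
    and even: "quarter_phase (Cayley_graph G (insert z T)) (\<lambda>u. std_basis \<one> u + std_basis z u)"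
  shows "admits_PST (Cayley_graph G (insert z T))"
proof (rule admits_PST_if_quarter_phase[where a = \<one> and b = z])
  fix u assume "u \<in> pverts (Cayley_graph G (insert z T))"
  then have u: "u \<in> carrier G" by simp
  let ?f = "\<lambda>u. std_basis \<one> u - std_basis z u"
  have "inv u \<in> T \<longleftrightarrow> z \<otimes> inv u \<in> T"
    using T(2)[of "inv u"] T(2)[of "z \<otimes> inv u"] z u by (auto simp flip: m_assoc)
  then have T0: "(\<Sum>s\<in>T. ?f (s \<otimes> u)) = 0"
    using fin z T u by (simp add: sum_subtractf sum_std_basis_translates)
  have zu: "z \<otimes> u = \<one> \<longleftrightarrow> u = z" "z \<otimes> u = z \<longleftrightarrow> u = \<one>"
    using z u by (metis m_assoc r_one l_one, metis m_assoc r_one l_one)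
  have "mat_vec_on (carrier G) (adjacency_matrix (Cayley_graph G (insert z T))) ?f u
      = (\<Sum>s\<in>insert z T. ?f (s \<otimes> u))"
    using fin z T u by (intro mat_vec_on_Cayley_graph) auto
  also have "\<dots> = ?f (z \<otimes> u)"
    using z finite_subset[OF T(1) fin] T0 by simp
  also have "\<dots> = - ?f u" by (simp add: std_basis_def zu)
  finally show "mat_vec_on (pverts (Cayley_graph G (insert z T)))
      (adjacency_matrix (Cayley_graph G (insert z T))) ?f u = - ?f u"
    by simp
qed (use fin z even in auto)

lemma connected_Cayley_graph:
  assumes "finite (carrier G)" "S \<subseteq> carrier G - {\<one>}" "inverse_closed G S"
    and gen: "generate G S = carrier G"
  shows "Digraph_Component.connected (with_proj (Cayley_graph G S))"
proof -
  let ?X = "Cayley_graph G S"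
  interpret X: pair_graph ?X by (rule pair_graph_Cayley_graph) (use assms in \<open>simp_all add: is_group\<close>)
  have S: "S \<subseteq> carrier G" using assms by blast
  have step: "reachable (with_proj ?X) g (s \<otimes> g)" if "s \<in> S" "g \<in> carrier G" for s g
    using that S by (intro X.reachable_adjI) (auto simp: Cayley_graph_def m_assoc)
  have reach: "reachable (with_proj ?X) g (x \<otimes> g)" if "x \<in> generate G S" "g \<in> carrier G" for x g
    using that
  proof (induction arbitrary: g)
    case one
    then show ?case by simp
  next
    case (incl h)
    then show ?case using step by blast
  next
    case (inv h)
    then show ?case using step assms(3) by (auto simp: inverse_closed_def)
  next
    case (eng h1 h2)
    then have "reachable (with_proj ?X) g (h2 \<otimes> g)" "reachable (with_proj ?X) (h2 \<otimes> g) (h1 \<otimes> (h2 \<otimes> g))"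
      by (simp_all add: gen)
    then show ?case using eng X.reachable_trans by (simp add: gen m_assoc) blast
  qed
  have "reachable (with_proj ?X) g h" if "g \<in> carrier G" "h \<in> carrier G" for g h
    using reach[of "h \<otimes> inv g" g] that by (simp add: gen m_assoc)
  then show ?thesis
    unfolding connected_def strongly_connected_def
    using X.reachable_mk_symmetricI by (auto simp: Cayley_graph_def)
qed

text \<open>In the complement the identity has the two neighbours \<open>x\<close> and
  \<open>y\<close>, which would force three vertices into a single copy of
  \<open>K_2\<close>.\<close>

lemma not_disjoint_union_of_K2_complement_Cayley_graph:
  assumes "x \<in> carrier G - {\<one>}" "y \<in> carrier G - {\<one>}" "x \<noteq> y" "x \<notin> S" "y \<notin> S"
  shows "\<not> disjoint_union_of_K2 (graph_complement (Cayley_graph G S))"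
proof
  assume "disjoint_union_of_K2 (graph_complement (Cayley_graph G S))"
  then obtain \<H> :: "'a pair_pre_digraph set" where
    K: "\<And>H. H \<in> \<H> \<Longrightarrow> complete_digraph 2 (with_proj H)"
    and disj: "pairwise (\<lambda>H H'. disjnt (pverts H) (pverts H')) \<H>"
    and arcs: "parcs (graph_complement (Cayley_graph G S)) = (\<Union>H\<in>\<H>. parcs H)"
    unfolding disjoint_union_of_K2_def by (elim exE conjE) (rule that, simp_all)
  have "(\<one>, x) \<in> parcs (graph_complement (Cayley_graph G S))"
    "(\<one>, y) \<in> parcs (graph_complement (Cayley_graph G S))"
    using assms by (auto simp: graph_complement_def Cayley_graph_def)
  then obtain H H' where H: "H \<in> \<H>" "(\<one>, x) \<in> parcs H" and H': "H' \<in> \<H>" "(\<one>, y) \<in> parcs H'"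
    unfolding arcs UN_iff by (elim bexE)
  have in_H: "\<one> \<in> pverts H" "x \<in> pverts H" and in_H': "\<one> \<in> pverts H'" "y \<in> pverts H'"
    using K[OF H(1)] K[OF H'(1)] H(2) H'(2) by (simp_all add: complete_digraph_pair_def)
  then have "\<not> disjnt (pverts H) (pverts H')" by (meson disjnt_iff)
  then have "H = H'" using pairwiseD[OF disj H(1) H'(1)] by blast
  then have "{\<one>, x, y} \<subseteq> pverts H" using in_H in_H' by blast
  moreover have "card (pverts H) = 2" "finite (pverts H)"
    using K[OF H(1)] by (auto simp: complete_digraph_pair_def)
  ultimately have "card {\<one>, x, y} \<le> 2" by (metis card_mono)
  then show False using assms by (auto simp: card_insert_if)
qed

lemma union_of_conjugacy_classesI:
  assumes S: "S \<subseteq> carrier G"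
    and conj: "\<And>g s. g \<in> carrier G \<Longrightarrow> s \<in> S \<Longrightarrow> g \<otimes> s \<otimes> inv g \<in> S"
  shows "union_of_conjugacy_classes G S"
  unfolding union_of_conjugacy_classes_def conjugacy_class_def
proof (intro exI conjI)
  show "S = (\<Union>x\<in>S. (\<lambda>g. g \<otimes> x \<otimes> inv g) ` carrier G)"
  proof (intro equalityI subsetI)
    fix s assume "s \<in> S"
    moreover from this S have "s = \<one> \<otimes> s \<otimes> inv \<one>" by (simp add: subsetD)
    ultimately show "s \<in> (\<Union>x\<in>S. (\<lambda>g. g \<otimes> x \<otimes> inv g) ` carrier G)" by blast
  qed (use conj in auto)
qed (rule S)

end

section \<open>The complement of a normal subgroup\<close>

definition PST_connection_set :: "('g, 'm) monoid_scheme \<Rightarrow> 'g set \<Rightarrow> bool" where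
  "PST_connection_set G S \<longleftrightarrow> S \<subseteq> carrier G - {\<one>\<^bsub>G\<^esub>} \<and> inverse_closed G S \<and>
     union_of_conjugacy_classes G S \<and>
     Digraph_Component.connected (with_proj (Cayley_graph G S)) \<and>
     admits_PST (Cayley_graph G S) \<and>
     \<not> disjoint_union_of_K2 (graph_complement (Cayley_graph G S))"

context group
begin

lemma subgroup_mult_mem_iff:
  assumes N: "subgroup N G" and "u \<in> N" "s \<in> carrier G"
  shows "s \<otimes> u \<in> N \<longleftrightarrow> s \<in> N" and "u \<otimes> s \<in> N \<longleftrightarrow> s \<in> N"
proof -
  have u: "u \<in> carrier G" using assms subgroup.subset by blast
  have inv: "inv u \<in> N" using N \<open>u \<in> N\<close> by (rule subgroup.m_inv_closed)
  have "(s \<otimes> u) \<otimes> inv u = s" "inv u \<otimes> (u \<otimes> s) = s"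
    using u \<open>s \<in> carrier G\<close> by (simp_all add: m_assoc flip: m_assoc[of "inv u" u s])
  then show "s \<otimes> u \<in> N \<longleftrightarrow> s \<in> N" "u \<otimes> s \<in> N \<longleftrightarrow> s \<in> N"
    using subgroup.m_closed[OF N] inv \<open>u \<in> N\<close> by metis+
qed

text \<open>Summing over \<open>carrier G - N\<close> is summing over the whole group minus summing
  over a coset of \<open>N\<close>. It annihilates functions with sum 0 on every coset, and is
  \<open>- card N\<close> on functions constant on cosets with total sum 0. Only the constants are
  left.\<close>

lemma admits_PST_complement_of_subgroup:
  assumes fin: "finite (carrier G)" and N: "subgroup N G"
    and z: "z \<in> N" "z \<noteq> \<one>" "z \<otimes> z = \<one>" and dvd: "4 dvd card N"
  shows "admits_PST (Cayley_graph G (insert z (carrier G - N)))"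
proof (rule admits_PST_Cayley_graph)
  interpret N: subgroup N G by (rule N)
  let ?X = "Cayley_graph G (insert z (carrier G - N))"
  have NG: "N \<subseteq> carrier G" by (rule N.subset)
  have zG: "z \<in> carrier G" using z NG by blast
  have finN: "finite N" using finite_subset[OF NG fin] .
  note mem = subgroup_mult_mem_iff[OF N]
  obtain m where m: "card N = 4 * m" using dvd by (elim dvdE)
  obtain n where "order G = card N * n"
    using lagrange[OF N] by (metis mult.commute)
  then have n: "card (carrier G) = 4 * m * n" by (simp add: order_def m)
  have pos: "m > 0" "n > 0"
    using m n fin finN card_gt_0_iff[of "carrier G"] card_gt_0_iff[of N] N.one_closed by auto
  have card_diff: "card (carrier G - N) = 4 * m * n - 4 * m"
    using NG finN by (simp add: card_Diff_subset m n)
  let ?e = "\<lambda>u. std_basis \<one> u + std_basis z u"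
  \<comment> \<open>Both functions are centred: \<open>?x0\<close> is \<open>?e\<close> minus its
    mean \<open>2 / card N\<close> over \<open>N\<close>, and \<open>?x1\<close> is the indicator of
    \<open>N\<close> minus its mean \<open>1 / n\<close> over the group, \<open>n\<close> being the
    index of \<open>N\<close>.\<close>
  let ?x0 = "\<lambda>u. ?e u + (- 2 / of_nat (card N)) * of_bool (u \<in> N)"
  let ?x1 = "\<lambda>u. of_bool (u \<in> N) - 1 / of_nat n :: complex"
  have eN: "of_bool (z \<otimes> u \<in> N) = (of_bool (u \<in> N) :: complex)" if "u \<in> carrier G" for u
    using mem(2)[OF z(1) that] by simp
  have zu: "z \<otimes> u = \<one> \<longleftrightarrow> u = z" "z \<otimes> u = z \<longleftrightarrow> u = \<one>" if "u \<in> carrier G" for u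
    using z(3) zG that by (metis m_assoc r_one l_one, metis m_assoc r_one l_one)
  have ee: "?e (z \<otimes> u) = ?e u" if "u \<in> carrier G" for u
    using zu[OF that] by (simp add: std_basis_def)
  have sumN: "(\<Sum>s\<in>carrier G - N. of_bool (s \<otimes> u \<in> N)) = (of_nat (card N) * of_bool (u \<notin> N) :: complex)"
    if u: "u \<in> carrier G" for u
  proof (cases "u \<in> N")
    case True
    then show ?thesis using mem(1)[OF True] by (auto intro!: sum.neutral)
  next
    case False
    \<comment> \<open>For \<open>u\<close> outside \<open>N\<close> the whole coset
      \<open>N \<otimes> inv u\<close> avoids \<open>N\<close>, so it counts in full.\<close>
    have "{s \<in> carrier G - N. s \<otimes> u \<in> N} = (\<lambda>h. h \<otimes> inv u) ` N"
    proof (intro equalityI subsetI)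
      fix s assume s: "s \<in> {s \<in> carrier G - N. s \<otimes> u \<in> N}"
      then have "s = (s \<otimes> u) \<otimes> inv u" using u by (simp add: m_assoc)
      then show "s \<in> (\<lambda>h. h \<otimes> inv u) ` N" using s by blast
    next
      fix s assume "s \<in> (\<lambda>h. h \<otimes> inv u) ` N"
      then obtain h where h: "h \<in> N" "s = h \<otimes> inv u" by blast
      then have "s \<otimes> u = h" using u NG by (auto simp: m_assoc)
      moreover have "s \<notin> N"
        using mem(2)[OF h(1), of "inv u"] h u False N.m_inv_closed[of "inv u"] by auto
      ultimately show "s \<in> {s \<in> carrier G - N. s \<otimes> u \<in> N}" using h u NG by auto
    qed
    moreover have "inj_on (\<lambda>h. h \<otimes> inv u) N"
      using u NG by (intro inj_onI) (auto simp: subset_iff)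
    ultimately have "card {s \<in> carrier G - N. s \<otimes> u \<in> N} = card N" by (simp add: card_image)
    then show ?thesis using False fin by (simp add: of_bool_def sum.If_cases Int_def)
  qed
  have sume: "(\<Sum>s\<in>carrier G - N. ?e (s \<otimes> u)) = 2 * of_bool (u \<notin> N)" if u: "u \<in> carrier G" for u
  proof -
    have "z \<otimes> inv u \<in> N \<longleftrightarrow> u \<in> N" "inv u \<in> N \<longleftrightarrow> u \<in> N"
      using mem(2)[OF z(1), of "inv u"] u N.m_inv_closed[of u] N.m_inv_closed[of "inv u"] by auto
    then show ?thesis
      using fin u zG by (simp add: sum.distrib sum_std_basis_translates)
  qed
  have x0: "quarter_phase ?X ?x0"
  proof (rule quarter_phase_Cayley_eigenvector[OF fin zG, where k = 0])
    show "?x0 (z \<otimes> u) = ?x0 u" if "u \<in> carrier G" for u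
      by (simp only: ee[OF that] eN[OF that])
    show "(\<Sum>s\<in>carrier G - N. ?x0 (s \<otimes> u)) = 4 * of_int 0 * ?x0 u" if "u \<in> carrier G" for u
      using sume[OF that] sumN[OF that] pos m
      by (simp add: sum.distrib sum_subtractf flip: sum_distrib_left sum_divide_distrib)
  qed (use z in auto)
  have x1: "quarter_phase ?X ?x1"
  proof (rule quarter_phase_Cayley_eigenvector[OF fin zG, where k = "- int m"])
    show "?x1 (z \<otimes> u) = ?x1 u" if "u \<in> carrier G" for u
      by (simp only: eN[OF that])
    show "(\<Sum>s\<in>carrier G - N. ?x1 (s \<otimes> u)) = 4 * of_int (- int m) * ?x1 u" if "u \<in> carrier G" for u
    proof -
      have "(\<Sum>s\<in>carrier G - N. ?x1 (s \<otimes> u))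
          = of_nat (card N) * of_bool (u \<notin> N) - of_nat (card (carrier G - N)) * (1 / of_nat n)"
        by (simp add: sum_subtractf sumN[OF that])
      also have "\<dots> = 4 * of_int (- int m) * ?x1 u"
        using pos by (simp add: m card_diff of_nat_diff field_simps)
      finally show ?thesis .
    qed
  qed (use z in auto)
  have one: "quarter_phase ?X (\<lambda>u. 1)"
    by (rule quarter_phase_Cayley_eigenvector[OF fin zG, where k = "int (m * n) - int m"])
      (use z pos in \<open>auto simp: card_diff of_nat_diff algebra_simps\<close>)
  have "quarter_phase ?X (\<lambda>u. ?x0 u + ((2 / of_nat (card N)) * ?x1 u + (2 / of_nat (card N) / of_nat n) * 1))"
    by (rule quarter_phase_add[OF x0 quarter_phase_add[OF quarter_phase_cmult[OF x1]
          quarter_phase_cmult[OF one]]])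
  then show "quarter_phase ?X ?e"
    by (rule quarter_phase_cong) (use pos m in \<open>simp add: field_simps\<close>)
  show "z \<otimes> s \<in> carrier G - N" if "s \<in> carrier G - N" for s
    using that mem(2)[OF z(1)] zG by auto
qed (use assms subgroup.subset[OF N] in auto)

text \<open>With \<open>x\<close> outside \<open>N\<close>, every \<open>g\<close> in
  \<open>N\<close> is the quotient of \<open>g \<otimes> x\<close> and \<open>x\<close>, both
  outside \<open>N\<close>.\<close>

lemma generate_complement_of_subgroup:
  assumes N: "subgroup N G" "N \<noteq> carrier G" and z: "z \<in> N"
  shows "generate G (insert z (carrier G - N)) = carrier G"
proof (intro equalityI subsetI)
  let ?S = "insert z (carrier G - N)"
  interpret N: subgroup N G by (rule N)
  have S: "?S \<subseteq> carrier G" using z N.subset by blast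
  show "g \<in> carrier G" if "g \<in> generate G ?S" for g
    using generate_in_carrier[OF S that] .
  obtain x where x: "x \<in> carrier G" "x \<notin> N" using N N.subset by blast
  fix g assume g: "g \<in> carrier G"
  show "g \<in> generate G ?S"
  proof (cases "g \<in> N")
    case True
    have "g \<otimes> x \<notin> N" using subgroup_mult_mem_iff(2)[OF N(1) True x(1)] x(2) by simp
    then have "g \<otimes> x \<in> ?S" using g x by simp
    then have "(g \<otimes> x) \<otimes> inv x \<in> generate G ?S"
      using x by (intro generate.eng generate.incl generate.inv) auto
    then show ?thesis using g x by (simp add: m_assoc)
  qed (use g in \<open>auto intro: generate.incl\<close>)
qed

lemma PST_connection_set_complement_of_normal_subgroup:
  assumes fin: "finite (carrier G)" and N: "N \<lhd> G" "N \<noteq> carrier G"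
    and z: "z \<in> N" "z \<noteq> \<one>" "z \<otimes> z = \<one>" and central: "\<And>g. g \<in> carrier G \<Longrightarrow> g \<otimes> z = z \<otimes> g"
    and dvd: "4 dvd card N"
  shows "PST_connection_set G (insert z (carrier G - N))" (is "PST_connection_set G ?S")
proof -
  interpret N: normal N G by (rule N)
  have sub: "subgroup N G" by (rule N.is_subgroup)
  have zG: "z \<in> carrier G" using z N.subset by blast
  have S: "?S \<subseteq> carrier G - {\<one>}" using z zG by auto
  have inv_z: "inv z = z" using z zG by (simp add: inv_equality)
  have "inv s \<notin> N" if "s \<in> carrier G" "s \<notin> N" for s
    using that N.m_inv_closed inv_inv by metis
  then have "inv s \<in> ?S" if "s \<in> ?S" for s
    using that inv_z by auto
  then have inv: "inverse_closed G ?S" by (simp add: inverse_closed_def)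
  have "union_of_conjugacy_classes G ?S"
  proof (rule union_of_conjugacy_classesI)
    fix g s assume g: "g \<in> carrier G" and s: "s \<in> ?S"
    show "g \<otimes> s \<otimes> inv g \<in> ?S"
    proof (cases "s = z")
      case True
      then show ?thesis using g zG by (simp add: central m_assoc)
    next
      case False
      have "g \<otimes> s \<otimes> inv g \<notin> N"
      proof
        assume "g \<otimes> s \<otimes> inv g \<in> N"
        then have "inv g \<otimes> (g \<otimes> s \<otimes> inv g) \<otimes> g \<in> N" using g by (rule N.inv_op_closed1[rotated])
        moreover have "inv g \<otimes> (g \<otimes> s \<otimes> inv g) \<otimes> g = s"
          using g s zG by (auto simp: m_assoc simp flip: m_assoc[of "inv g" g])
        ultimately show False using s False by simp
      qed
      then show ?thesis using g s zG by auto
    qed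
  qed (use S in auto)
  moreover have "Digraph_Component.connected (with_proj (Cayley_graph G ?S))"
    using fin S inv generate_complement_of_subgroup[OF sub N(2) z(1)]
    by (rule connected_Cayley_graph)
  moreover have "admits_PST (Cayley_graph G ?S)"
    using fin sub z dvd by (rule admits_PST_complement_of_subgroup)
  moreover have "\<not> disjoint_union_of_K2 (graph_complement (Cayley_graph G ?S))"
  proof -
    have finN: "finite N" using finite_subset[OF N.subset fin] .
    have "card N > 0" using finN z by (auto simp: card_gt_0_iff)
    \<comment> \<open>Four elements leave two in \<open>N\<close> besides the identity and
      \<open>z\<close>; these lie outside the connection set.\<close>
    then have "card N \<ge> 4" using dvd by (simp add: dvd_imp_le)
    then have "2 \<le> card (N - {\<one>, z})"
      using z N.one_closed finN by (simp add: card_Diff_subset)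
    then obtain X where X: "X \<subseteq> N - {\<one>, z}" "card X = 2"
      by (rule obtain_subset_with_card_n)
    then obtain x y where "X = {x, y}" "x \<noteq> y" by (auto simp: card_2_iff)
    with X(1) have "x \<in> N - {\<one>, z}" "y \<in> N - {\<one>, z}" "x \<noteq> y" by auto
    then show ?thesis using N.subset
      by (intro not_disjoint_union_of_K2_complement_Cayley_graph[of x y]) auto
  qed
  ultimately show ?thesis using S inv by (simp add: PST_connection_set_def)
qed

end

section \<open>Transvections in dimension two\<close>

definition mat2 :: "'a \<Rightarrow> 'a \<Rightarrow> 'a \<Rightarrow> 'a \<Rightarrow> 'a::zero^2^2" where
  "mat2 a b c d = vector [vector [a, b], vector [c, d]]"

lemma mat2_nth [simp]:
  "mat2 a b c d $ 1 $ 1 = a" "mat2 a b c d $ 1 $ 2 = b"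
  "mat2 a b c d $ 2 $ 1 = c" "mat2 a b c d $ 2 $ 2 = d"
  by (simp_all add: mat2_def)

lemma mat_1_nth_2 [simp]:
  "(mat 1 :: 'a::zero_neq_one^2^2) $ 1 $ 1 = 1" "(mat 1 :: 'a^2^2) $ 1 $ 2 = 0"
  "(mat 1 :: 'a^2^2) $ 2 $ 1 = 0" "(mat 1 :: 'a^2^2) $ 2 $ 2 = 1"
  by (simp_all add: mat_def)

lemma matrix_mult_nth_2: "((A :: 'a::semiring_1^2^2) ** B) $ i $ j = A $ i $ 1 * B $ 1 $ j + A $ i $ 2 * B $ 2 $ j"
  by (simp add: matrix_matrix_mult_def sum_2)

lemma matrix_vector_mult_nth_2: "((A :: 'a::semiring_1^2^2) *v x) $ i = A $ i $ 1 * x $ 1 + A $ i $ 2 * x $ 2"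
  by (simp add: matrix_vector_mult_def sum_2)

lemma trace_2: "trace (A :: 'a::semiring_1^2^2) = A $ 1 $ 1 + A $ 2 $ 2"
  by (simp add: trace_def sum_2)

lemma vec_eq_iff_2: "(x :: 'a^2) = y \<longleftrightarrow> x $ 1 = y $ 1 \<and> x $ 2 = y $ 2"
  by (simp add: vec_eq_iff forall_2)

lemma mat_eq_iff_2:
  "(A :: 'a^2^2) = B \<longleftrightarrow>
     A $ 1 $ 1 = B $ 1 $ 1 \<and> A $ 1 $ 2 = B $ 1 $ 2 \<and> A $ 2 $ 1 = B $ 2 $ 1 \<and> A $ 2 $ 2 = B $ 2 $ 2"
  by (auto simp: vec_eq_iff forall_2)

lemmas mat2_simps = mat_eq_iff_2 matrix_mult_nth_2 matrix_vector_mult_nth_2 trace_2 det_2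

lemma matrix_mult_uminus_left: "(- A) ** B = - ((A :: 'a::ring_1^'n^'m) ** B)"
  by (simp add: matrix_matrix_mult_def vec_eq_iff sum_negf)

lemma matrix_mult_uminus_right: "A ** (- B) = - ((A :: 'a::ring_1^'n^'m) ** B)"
  by (simp add: matrix_matrix_mult_def vec_eq_iff sum_negf)

text \<open>The determinant with columns \<open>v\<close> and \<open>w\<close>. For nonzero vectors
  over a field it vanishes exactly when they are proportional, so it compares points of the
  projective line.\<close>

definition symp :: "'a::comm_ring_1^2 \<Rightarrow> 'a^2 \<Rightarrow> 'a" where
  "symp v w = v $ 1 * w $ 2 - v $ 2 * w $ 1"

definition transvection :: "'a::comm_ring_1^2 \<Rightarrow> 'a \<Rightarrow> 'a^2^2" where
  "transvection v c =
     mat2 (1 - c * v$1 * v$2) (c * v$1 * v$1) (- c * v$2 * v$2) (1 + c * v$1 * v$2)"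

lemma transvection_mult_vec: "transvection v c *v x = x + (c * symp v x) *s v"
  by (simp add: transvection_def symp_def vec_eq_iff_2 mat2_simps algebra_simps)

text \<open>A transvection is the identity plus \<open>c\<close> times a matrix of rank at most one,
  so the trace is affine in \<open>c\<close>. Counting transvections with a prescribed trace thus
  becomes solving linear equations.\<close>

lemma trace_transvection_mult: "trace (transvection v c ** A) = trace A + c * symp v (A *v v)"
  by (simp add: transvection_def symp_def mat2_simps algebra_simps)

text \<open>Representatives of the points of the projective line.\<close>

definition lines :: "('a::zero_neq_one^2) set" where
  "lines = insert (vector [0, 1]) (range (\<lambda>y. vector [1, y]))"

text \<open>Determinant 1 and trace 2 say that the characteristic polynomial is
  \<open>(X - 1)^2\<close>.\<close>

definition unipotents :: "('a::field^2^2) set" where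
  "unipotents = {A. det A = 1 \<and> trace A = 2 \<and> A \<noteq> mat 1}"

lemma symp_add_scale_right: "symp w (x + c *s v) = symp w x + c * symp w v"
  by (simp add: symp_def algebra_simps)

lemma card_lines: "card (lines :: ('a::{field,finite}^2) set) = CARD('a) + 1"
proof -
  have "inj (\<lambda>y::'a. vector [1, y] :: 'a^2)"
    by (rule injI) (simp add: vec_eq_iff_2)
  then have "card (range (\<lambda>y::'a. vector [1, y] :: 'a^2)) = CARD('a)"
    by (rule card_image)
  moreover have "vector [0, 1] \<notin> range (\<lambda>y::'a. vector [1, y] :: 'a^2)"
    by (auto simp: vec_eq_iff_2)
  ultimately show ?thesis by (simp add: lines_def)
qed

lemma ex1_line:
  fixes x :: "'a::field^2"
  assumes "x \<noteq> 0"
  shows "\<exists>!v. v \<in> lines \<and> symp v x = 0"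
proof (cases "x $ 1 = 0")
  case True
  then have "x $ 2 \<noteq> 0" using assms by (simp add: vec_eq_iff_2)
  then show ?thesis using True
    by (intro ex1I[of _ "vector [0, 1]"]) (auto simp: lines_def symp_def)
next
  case False
  then show ?thesis
    by (intro ex1I[of _ "vector [1, x $ 2 / x $ 1]"]) (auto simp: lines_def symp_def field_simps)
qed

lemma line_nonzero: "v \<in> lines \<Longrightarrow> (v :: 'a::field^2) \<noteq> 0"
  by (auto simp: lines_def vec_eq_iff_2)

lemma symp_self [simp]: "symp v v = 0"
  by (simp add: symp_def)

lemma symp_commute: "symp v w = - symp w v"
  by (simp add: symp_def)

lemma lines_eq_if_symp_eq_0:
  fixes v w :: "'a::field^2"
  shows "v \<in> lines \<Longrightarrow> w \<in> lines \<Longrightarrow> symp v w = 0 \<longleftrightarrow> v = w"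
  using ex1_line[OF line_nonzero, of w] by auto

lemma transvection_in_unipotents:
  assumes "v \<in> lines" "c \<noteq> 0"
  shows "transvection v c \<in> unipotents"
  using assms by (auto simp: unipotents_def transvection_def lines_def mat2_simps algebra_simps)

text \<open>A unipotent other than the identity fixes a single line, and the scalar is determined
  once a vector on that line is chosen. Rescaling \<open>v\<close> by \<open>t\<close> multiplies
  the scalar that \<open>c\<close> stands for by \<open>t^2\<close>, hence the fixed representatives
  in \<open>lines\<close>.\<close>

lemma bij_betw_transvection:
  "bij_betw (\<lambda>(v, c). transvection v c) (lines \<times> (- {0})) (unipotents :: ('a::field^2^2) set)"
proof (rule bij_betwI')
  fix p r :: "('a^2) \<times> 'a"
  assume p: "p \<in> lines \<times> (- {0})" and r: "r \<in> lines \<times> (- {0})"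
  obtain v c v' c' where vc: "p = (v, c)" "r = (v', c')" by (cases p, cases r)
  show "((case p of (v, c) \<Rightarrow> transvection v c) = (case r of (v, c) \<Rightarrow> transvection v c)) \<longleftrightarrow> p = r"
    using p r unfolding vc by (auto simp: transvection_def lines_def mat2_simps)
next
  fix p :: "('a^2) \<times> 'a" assume "p \<in> lines \<times> (- {0})"
  then show "(case p of (v, c) \<Rightarrow> transvection v c) \<in> unipotents"
    by (auto intro: transvection_in_unipotents)
next
  fix A :: "'a^2^2" assume A: "A \<in> unipotents"
  then have tr: "A $ 1 $ 1 = 2 - A $ 2 $ 2" and det: "A $ 1 $ 1 * A $ 2 $ 2 - A $ 1 $ 2 * A $ 2 $ 1 = 1"
    and ne: "A \<noteq> mat 1"
    by (simp_all add: unipotents_def mat2_simps eq_diff_eq)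
  have sq: "A $ 1 $ 2 * A $ 2 $ 1 = (1 - A $ 2 $ 2) * (A $ 2 $ 2 - 1)"
    using det unfolding tr by (simp add: algebra_simps)
  have "\<exists>v\<in>lines. \<exists>c\<in>-{0}. A = transvection v c"
  proof (cases "A $ 1 $ 2 = 0")
    case True
    then have "A $ 2 $ 2 = 1" using sq by simp
    then have "A = transvection (vector [0, 1]) (- A $ 2 $ 1)" "A $ 2 $ 1 \<noteq> 0"
      using True tr ne by (simp_all add: transvection_def mat2_simps)
    then show ?thesis by (intro bexI[of _ "vector [0, 1]"] bexI[of _ "- A $ 2 $ 1"]) (auto simp: lines_def)
  next
    case False
    have "A $ 2 $ 1 = (1 - A $ 2 $ 2) * (A $ 2 $ 2 - 1) / A $ 1 $ 2"
      using sq False by (simp add: field_simps)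
    \<comment> \<open>For \<open>v = (1, y)\<close> the entry (1,2) is \<open>c\<close> and the
      entry (2,2) is \<open>1 + c * y\<close>; \<open>y\<close> is solved from the latter.\<close>
    then have "A = transvection (vector [1, (A $ 2 $ 2 - 1) / A $ 1 $ 2]) (A $ 1 $ 2)"
      using False tr by (simp add: transvection_def mat2_simps)
    then show ?thesis using False
      by (intro bexI[of _ "vector [1, (A $ 2 $ 2 - 1) / A $ 1 $ 2]"] bexI[of _ "A $ 1 $ 2"])
        (auto simp: lines_def)
  qed
  then show "\<exists>p\<in>lines \<times> (- {0}). A = (case p of (v, c) \<Rightarrow> transvection v c)" by auto
qed

lemma sum_unipotents:
  fixes f :: "'a::{field,finite}^2^2 \<Rightarrow> complex"
  shows "sum f unipotents = (\<Sum>v\<in>lines. \<Sum>c\<in>-{0}. f (transvection v c))"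
  unfolding sum.cartesian_product
  by (subst sum.reindex_bij_betw[OF bij_betw_transvection, symmetric]) (simp add: case_prod_unfold)

section \<open>Counting transvections by linear equations in the scalar\<close>

lemma sum_of_bool_ex1:
  assumes "finite A" "\<exists>!v. v \<in> A \<and> Q v"
  shows "(\<Sum>v\<in>A. of_bool (Q v)) = (1 :: complex)"
proof -
  obtain a where "a \<in> A" "Q a" "\<And>v. v \<in> A \<Longrightarrow> Q v \<longleftrightarrow> v = a" using assms(2) by blast
  then have "(\<Sum>v\<in>A. of_bool (Q v)) = (\<Sum>v\<in>A. if v = a then 1 else (0::complex))"
    by (intro sum.cong) auto
  then show ?thesis using assms(1) \<open>a \<in> A\<close> by simp
qed

lemma sum_linear_solutions:
  fixes a b :: "'a::{field,finite}"
  shows "(\<Sum>c\<in>-{0}. of_bool (a + c * b = 0)) =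
     (if b = 0 then (of_nat CARD('a) - 1) * of_bool (a = 0) else of_bool (a \<noteq> 0) :: complex)"
proof (cases "b = 0")
  case True
  have "card (- {0 :: 'a}) = CARD('a) - 1" by (simp add: Compl_eq_Diff_UNIV)
  moreover have "CARD('a) > 0" by simp
  ultimately show ?thesis using True by (simp add: of_nat_diff Suc_leI)
next
  case False
  show ?thesis
  proof (cases "a = 0")
    case True
    then show ?thesis using False by (auto intro!: sum.neutral)
  next
    case a: False
    have "\<exists>!c. c \<in> - {0} \<and> a + c * b = 0"
      using False a by (intro ex1I[of _ "- a / b"]) (auto simp: field_simps eq_neg_iff_add_eq_0)
    then have "(\<Sum>c\<in>-{0}. of_bool (a + c * b = 0)) = (1 :: complex)"
      by (intro sum_of_bool_ex1) simp_all
    then show ?thesis unfolding \<open>_ = 1\<close> using False a by simp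
  qed
qed

text \<open>On invertible matrices, the permutation character of the projective line, that is 1 plus
  the Steinberg character.\<close>

definition fixed_lines :: "'a::{field,finite}^2^2 \<Rightarrow> complex" where
  "fixed_lines A = (\<Sum>v\<in>lines. of_bool (symp v (A *v v) = 0))"

lemma fixed_lines_uminus: "fixed_lines (- A) = fixed_lines A"
proof -
  have "symp v (- A *v v) = - symp v (A *v v)" for v
    by (simp add: symp_def mat2_simps algebra_simps)
  then show ?thesis by (simp add: fixed_lines_def)
qed

lemma fixed_lines_one: "fixed_lines (mat 1 :: 'a::{field,finite}^2^2) = of_nat CARD('a) + 1"
  by (simp add: fixed_lines_def card_lines)

text \<open>For a transvection along \<open>w\<close>, \<open>symp v (A *v v)\<close> is
  \<open>- c\<close> times the square of \<open>symp w v\<close>, so only the line of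
  \<open>w\<close> is fixed.\<close>

lemma fixed_lines_unipotent:
  fixes A :: "'a::{field,finite}^2^2"
  assumes "A \<in> unipotents"
  shows "fixed_lines A = 1"
proof -
  obtain w c where wc: "A = transvection w c" "w \<in> lines" "c \<noteq> 0"
    using assms bij_betw_transvection by (force simp: bij_betw_def)
  have "symp v (A *v v) = - c * (symp w v * symp w v)" for v
    unfolding wc transvection_mult_vec symp_add_scale_right by (simp add: symp_commute[of v w])
  then have "symp v (A *v v) = 0 \<longleftrightarrow> v = w" if "v \<in> lines" for v
    using that wc lines_eq_if_symp_eq_0[of w v] by auto
  then have "fixed_lines A = (\<Sum>v\<in>lines. of_bool (v = w))"
    unfolding fixed_lines_def by (intro sum.cong) simp_all
  also have "\<dots> = 1" using wc by (intro sum_of_bool_ex1) auto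
  finally show ?thesis .
qed

text \<open>Turns the product of functions occurring in \<open>sum_unipotents_trace\<close> into a
  linear combination; without this the span of the four functions would not be visibly
  invariant.\<close>

lemma fixed_lines_trace_2:
  fixes A :: "'a::{field,finite}^2^2"
  assumes "det A = 1"
  shows "fixed_lines A * of_bool (trace A = 2) =
    of_bool (trace A = 2) + of_nat CARD('a) * of_bool (A = mat 1)"
proof (cases "A = mat 1")
  case True
  have "trace (mat 1 :: 'a^2^2) = 2" by (simp add: trace_2)
  then show ?thesis using True by (simp add: fixed_lines_one)
next
  case False
  then show ?thesis using assms fixed_lines_unipotent[of A] by (simp add: unipotents_def)
qed

text \<open>Given two lines, equal or not, exactly \<open>q - 1\<close> unipotents carry the first
  to the second. Summing over the \<open>q + 1\<close> lines \<open>w\<close> and their images under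
  \<open>A\<close> gives a value that does not depend on \<open>A\<close>.\<close>

lemma sum_unipotents_fixed_lines:
  fixes A :: "'a::{field,finite}^2^2"
  assumes "invertible A"
  shows "(\<Sum>u\<in>unipotents. fixed_lines (u ** A)) = (of_nat CARD('a))\<^sup>2 - 1"
proof -
  let ?q = "of_nat CARD('a) :: complex"
  have inner: "(\<Sum>v\<in>lines. \<Sum>c\<in>-{0}. of_bool (symp w (transvection v c *v x) = 0)) = ?q - 1"
    if w: "w \<in> lines" and x: "x \<noteq> 0" for w x :: "'a^2"
  proof -
    \<comment> \<open>\<open>v1\<close> is the line of \<open>x\<close>. Transvections along
      \<open>v1\<close> fix \<open>x\<close>, and those along \<open>w\<close> leave
      \<open>symp w\<close> unchanged; for every other \<open>v\<close> the condition is linear in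
      \<open>c\<close> with nonzero slope.\<close>
    obtain v1 where v1: "v1 \<in> lines" "\<And>v. v \<in> lines \<Longrightarrow> symp v x = 0 \<longleftrightarrow> v = v1"
      using ex1_line[OF x] by blast
    have w': "symp w v = 0 \<longleftrightarrow> v = w" if "v \<in> lines" for v
      using lines_eq_if_symp_eq_0[OF w that] by auto
    have "(\<Sum>c\<in>-{0}. of_bool (symp w (transvection v c *v x) = 0)) =
      (if v = v1 \<or> v = w then (?q - 1) * of_bool (w = v1) else of_bool (w \<noteq> v1) :: complex)"
      if v: "v \<in> lines" for v
      using sum_linear_solutions[of "symp w x" "symp v x * symp w v"] v1(2)[OF v] v1(2)[OF w] w'[OF v]
      by (simp add: transvection_mult_vec symp_add_scale_right mult.assoc)
    then have "(\<Sum>v\<in>lines. \<Sum>c\<in>-{0}. of_bool (symp w (transvection v c *v x) = 0)) =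
      (\<Sum>v\<in>lines. if v = v1 \<or> v = w then (?q - 1) * of_bool (w = v1) else of_bool (w \<noteq> v1) :: complex)"
      by (rule sum.cong[OF refl])
    also have "\<dots> = ?q - 1"
    proof (cases "w = v1")
      case True
      then show ?thesis using w by simp
    next
      case False
      have "lines \<inter> - {v. v = v1 \<or> v = w} = lines - {v1, w}" by blast
      moreover have "card (lines - {v1, w}) = CARD('a) - 1"
        using w v1(1) False by (simp add: card_Diff_subset card_lines)
      moreover have "CARD('a) > 0" by simp
      ultimately show ?thesis using False by (simp add: sum.If_cases of_nat_diff Suc_leI)
    qed
    finally show ?thesis .
  qed
  have nz: "A *v w \<noteq> 0" if "w \<in> lines" for w
  proof
    assume "A *v w = 0"
    obtain A' where "A' ** A = mat 1" using assms by (auto simp: invertible_def)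
    then have "w = A' *v (A *v w)" by (simp add: matrix_vector_mul_assoc)
    then show False using \<open>A *v w = 0\<close> line_nonzero[OF that] by simp
  qed
  have "(\<Sum>u\<in>unipotents. fixed_lines (u ** A)) = (\<Sum>v\<in>lines. \<Sum>c\<in>-{0}. \<Sum>w\<in>lines.
      of_bool (symp w (transvection v c *v (A *v w)) = 0))"
    by (simp add: sum_unipotents fixed_lines_def matrix_vector_mul_assoc)
  also have "\<dots> = (\<Sum>v\<in>lines. \<Sum>w\<in>lines. \<Sum>c\<in>-{0}.
      of_bool (symp w (transvection v c *v (A *v w)) = 0))"
    by (intro sum.cong refl sum.swap)
  also have "\<dots> = (\<Sum>w\<in>lines. \<Sum>v\<in>lines. \<Sum>c\<in>-{0}.
      of_bool (symp w (transvection v c *v (A *v w)) = 0))"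
    by (rule sum.swap)
  also have "\<dots> = (\<Sum>w\<in>(lines :: ('a^2) set). ?q - 1)"
    using inner nz by (intro sum.cong) simp_all
  also have "\<dots> = ?q\<^sup>2 - 1" by (simp add: card_lines power2_eq_square algebra_simps)
  finally show ?thesis .
qed

text \<open>Along a line fixed by \<open>A\<close> the trace never changes. Along any other line
  exactly one scalar produces the trace \<open>t\<close>, and it is the excluded scalar 0 precisely
  when \<open>A\<close> already has trace \<open>t\<close>.\<close>

lemma sum_unipotents_trace:
  fixes A :: "'a::{field,finite}^2^2"
  shows "(\<Sum>u\<in>unipotents. of_bool (trace (u ** A) = t)) =
    (of_nat CARD('a) - 1) * (fixed_lines A * of_bool (trace A = t)) +
    (of_nat CARD('a) + 1 - fixed_lines A) * (1 - of_bool (trace A = t))"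
proof -
  let ?q = "of_nat CARD('a) :: complex" and ?b = "of_bool (trace A = t) :: complex"
  let ?f = "\<lambda>v. of_bool (symp v (A *v v) = 0) :: complex"
  have "(\<Sum>c\<in>-{0}. of_bool (trace (transvection v c ** A) = t)) =
      (?q - 1) * ?b * ?f v + (1 - ?b) * (1 - ?f v)" for v
  proof -
    have "trace A - t + c * symp v (A *v v) = 0 \<longleftrightarrow> trace (transvection v c ** A) = t" for c
      by (simp add: trace_transvection_mult algebra_simps)
    then show ?thesis
      using sum_linear_solutions[of "trace A - t" "symp v (A *v v)"] by simp
  qed
  then have "(\<Sum>u\<in>unipotents. of_bool (trace (u ** A) = t)) =
      (\<Sum>v\<in>lines. (?q - 1) * ?b * ?f v + (1 - ?b) * (1 - ?f v))"
    by (simp add: sum_unipotents)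
  also have "\<dots> = (?q - 1) * ?b * fixed_lines A + (1 - ?b) * (?q + 1 - fixed_lines A)"
    by (simp add: sum.distrib sum_subtractf fixed_lines_def card_lines add.commute flip: sum_distrib_left)
  finally show ?thesis by (simp add: mult_ac)
qed

section \<open>The special linear group\<close>

lemma SL2_simps: "carrier SL2 = {A. det A = 1}" "mult SL2 = (**)" "one SL2 = mat 1"
  by (simp_all add: SL2_def)

lemma sum_unipotents_eq_one:
  fixes A :: "'a::{field,finite}^2^2"
  assumes "det A = 1"
  shows "(\<Sum>u\<in>unipotents. of_bool (u ** A = mat 1)) = (of_bool (trace A = 2) - of_bool (A = mat 1) :: complex)"
proof -
  \<comment> \<open>The adjugate, which is the inverse since the determinant is 1. It has the same
    trace as \<open>A\<close>, so it is unipotent together with \<open>A\<close>.\<close>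
  define A' where "A' = mat2 (A$2$2) (- A$1$2) (- A$2$1) (A$1$1)"
  have A': "A' ** A = mat 1" "A ** A' = mat 1"
    using assms by (simp_all add: A'_def mat2_simps algebra_simps)
  have A'1: "A' = mat 1 \<longleftrightarrow> A = mat 1" by (auto simp: A'_def mat2_simps)
  have tr: "trace A' = trace A" and det: "det A' = 1"
    using assms by (simp_all add: A'_def mat2_simps algebra_simps)
  have "u ** A = mat 1 \<longleftrightarrow> u = A'" for u
    using A' by (metis matrix_mul_assoc matrix_mul_lid matrix_mul_rid)
  then have "(\<Sum>u\<in>unipotents. of_bool (u ** A = mat 1)) = (\<Sum>u\<in>unipotents. if u = A' then 1 else 0 :: complex)"
    by (intro sum.cong) auto
  also have "\<dots> = of_bool (A' \<in> unipotents)" by simp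
  also have "A' \<in> unipotents \<longleftrightarrow> trace A = 2 \<and> A \<noteq> mat 1"
    by (simp add: unipotents_def tr det A'1)
  also have "of_bool \<dots> = (of_bool (trace A = 2) - of_bool (A = mat 1) :: complex)"
    by (auto simp: trace_2)
  finally show ?thesis .
qed

lemma sum_unipotents_trace_2:
  fixes A :: "'a::{field,finite}^2^2"
  assumes "det A = 1"
  shows "(\<Sum>u\<in>unipotents. of_bool (trace (u ** A) = 2)) =
    of_nat CARD('a) + 1 - fixed_lines A - of_bool (trace A = 2) + (of_nat CARD('a))\<^sup>2 * of_bool (A = mat 1)"
  unfolding sum_unipotents_trace right_diff_distrib left_diff_distrib fixed_lines_trace_2[OF assms]
  by (simp add: algebra_simps power2_eq_square)

lemma card_unipotents:
  "of_nat (card (unipotents :: ('a::{field,finite}^2^2) set)) = (of_nat CARD('a))\<^sup>2 - (1 :: complex)"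
proof -
  have "of_nat (card (unipotents :: ('a^2^2) set)) = (\<Sum>u\<in>(unipotents :: ('a^2^2) set). 1 :: complex)"
    by simp
  also have "\<dots> = (of_nat CARD('a) + 1) * (of_nat CARD('a) - 1)"
    \<comment> \<open>With both coefficients 0 every nonzero scalar is a solution, so this counts
      them.\<close>
    using sum_linear_solutions[of "0::'a" 0]
    by (subst sum_unipotents) (simp add: card_lines)
  finally show ?thesis by (simp add: power2_eq_square algebra_simps)
qed

lemma det_uminus_2: "det (- A) = det (A :: 'a::comm_ring_1^2^2)"
  by (simp add: det_2)

lemma trace_uminus_2: "trace (- A) = - trace (A :: 'a::comm_ring_1^2^2)"
  by (simp add: trace_2)

definition pm_unipotents :: "('a::field^2^2) set" where
  "pm_unipotents = unipotents \<union> uminus ` unipotents"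

text \<open>The source of the factor 2. The two halves are told apart by their traces 2 and -2,
  which differ because \<open>4 \<noteq> 0\<close>.\<close>

lemma sum_pm_unipotents:
  fixes f :: "'a::{field,finite}^2^2 \<Rightarrow> complex"
  assumes "(4 :: 'a) \<noteq> 0" and "\<And>A. det A = 1 \<Longrightarrow> f (- A) = f A" and "det B = 1"
  shows "(\<Sum>u\<in>pm_unipotents. f (u ** B)) = 2 * (\<Sum>u\<in>unipotents. f (u ** B))"
proof -
  have "(2 :: 'a) \<noteq> - 2"
  proof
    assume "(2 :: 'a) = - 2"
    then have "(2 :: 'a) + 2 = 0" by (simp only: eq_neg_iff_add_eq_0)
    then show False using assms(1) by simp
  qed
  then have disj: "unipotents \<inter> uminus ` unipotents = ({} :: ('a^2^2) set)"
    by (auto simp: unipotents_def trace_uminus_2)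
  have "(\<Sum>u\<in>uminus ` unipotents. f (u ** B)) = (\<Sum>u\<in>unipotents. f (- (u ** B)))"
    by (subst sum.reindex) (simp_all add: inj_on_def matrix_mult_uminus_left)
  also have "\<dots> = (\<Sum>u\<in>unipotents. f (u ** B))"
    using assms by (intro sum.cong) (auto simp: unipotents_def det_mul)
  finally show ?thesis
    using disj by (simp add: pm_unipotents_def sum.union_disjoint)
qed

lemma quarter_phase_SL2:
  fixes f :: "'a::{field,finite}^2^2 \<Rightarrow> complex"
  assumes four: "(4 :: 'a) \<noteq> 0" and even: "\<And>A. det A = 1 \<Longrightarrow> f (- A) = f A"
    and eig: "\<And>A. det A = 1 \<Longrightarrow> (\<Sum>u\<in>unipotents. f (u ** A)) = 2 * of_int k * f A"
  shows "quarter_phase (Cayley_graph SL2 (insert (- mat 1) pm_unipotents)) f"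
proof (rule group.quarter_phase_Cayley_eigenvector[OF group_SL2, where k = k])
  show "- mat 1 \<in> carrier SL2" "- mat 1 \<notin> (pm_unipotents :: ('a^2^2) set)"
    "pm_unipotents \<subseteq> (carrier SL2 :: ('a^2^2) set)"
    using four
    by (auto simp: SL2_simps det_uminus_2 pm_unipotents_def unipotents_def trace_2 eq_neg_iff_add_eq_0 neg_eq_iff_add_eq_0)
  fix A :: "'a^2^2" assume "A \<in> carrier SL2"
  then have A: "det A = 1" by (simp add: SL2_simps)
  then show "f (- mat 1 \<otimes>\<^bsub>SL2\<^esub> A) = f A"
    using even by (simp add: SL2_simps matrix_mult_uminus_left)
  show "(\<Sum>s\<in>pm_unipotents. f (s \<otimes>\<^bsub>SL2\<^esub> A)) = 4 * of_int k * f A"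
    using sum_pm_unipotents[of f A, OF four even A] eig[OF A] by (simp add: SL2_simps)
qed simp

text \<open>Modulo \<open>fixed_lines\<close> and constants the class sum of the unipotents sends
  \<open>e\<close> to \<open>p - e\<close> and \<open>p\<close> to \<open>q^2 e - p\<close>, so
  \<open>q e + p\<close> and \<open>- q e + p\<close> have eigenvalues \<open>q - 1\<close> and
  \<open>- q - 1\<close>. The further terms of \<open>?x1\<close> and \<open>?x2\<close> are the
  corrections that make these relations exact.\<close>

lemma quarter_phase_SL2_center:
  assumes four: "(4 :: 'a::{field,finite}) \<noteq> 0" and odd: "odd CARD('a)"
  shows "quarter_phase (Cayley_graph SL2 (insert (- mat 1) pm_unipotents))
    (\<lambda>A :: 'a^2^2. of_bool (A = mat 1) + of_bool (A = - mat 1))"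
proof -
  let ?X = "Cayley_graph SL2 (insert (- mat 1) pm_unipotents) :: ('a^2^2) pair_pre_digraph"
  let ?q = "of_nat CARD('a) :: complex"
  define e where "e = (\<lambda>A :: 'a^2^2. of_bool (A = mat 1) + of_bool (- A = mat 1) :: complex)"
  define p where "p = (\<lambda>A :: 'a^2^2. of_bool (trace A = 2) + of_bool (trace (- A) = 2) :: complex)"
  let ?L = "\<lambda>f A. \<Sum>u\<in>(unipotents :: ('a^2^2) set). f (u ** A) :: complex"
  have Le: "?L e A = p A - e A" if A: "det A = 1" for A
  proof -
    have "?L e A = ?L (\<lambda>B. of_bool (B = mat 1)) A + ?L (\<lambda>B. of_bool (B = mat 1)) (- A)"
      by (simp only: e_def sum.distrib matrix_mult_uminus_right)
    also have "\<dots> = p A - e A"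
      using A by (simp only: sum_unipotents_eq_one det_uminus_2) (simp add: e_def p_def)
    finally show ?thesis .
  qed
  have Lp: "?L p A = 2 * (?q + 1) - 2 * fixed_lines A - p A + ?q\<^sup>2 * e A" if A: "det A = 1" for A
  proof -
    have "?L p A = ?L (\<lambda>B. of_bool (trace B = 2)) A + ?L (\<lambda>B. of_bool (trace B = 2)) (- A)"
      by (simp only: p_def sum.distrib matrix_mult_uminus_right)
    also have "\<dots> = 2 * (?q + 1) - 2 * fixed_lines A - p A + ?q\<^sup>2 * e A"
      using A by (simp only: sum_unipotents_trace_2 det_uminus_2 fixed_lines_uminus)
        (simp add: e_def p_def algebra_simps)
    finally show ?thesis .
  qed
  have Lfix: "?L fixed_lines A = ?q\<^sup>2 - 1" if "det A = 1" for A
    using that by (intro sum_unipotents_fixed_lines) (simp add: invertible_det_nz)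
  have even: "e (- A) = e A" "p (- A) = p A" for A
    by (simp_all add: e_def p_def)
  \<comment> \<open>With \<open>q = 2 m + 1\<close> the nonzero eigenvalues \<open>q^2 - 1\<close>,
    \<open>q - 1\<close> and \<open>- (q + 1)\<close> are twice \<open>2 m (m + 1)\<close>,
    \<open>m\<close> and \<open>- m - 1\<close>, the values of \<open>k\<close> below.\<close>
  obtain m where m: "CARD('a) = 2 * m + 1" using odd by (elim oddE)
  have q: "?q = 2 * of_nat m + 1" by (simp add: m)
  have "CARD('a) \<ge> 2"
    using card_mono[of UNIV "{0, 1 :: 'a}"] by simp
  then have "m > 0" using m by simp
  have nz: "?q - 1 \<noteq> 0" "?q + 1 \<noteq> 0" "?q \<noteq> 0" "?q\<^sup>2 - 1 \<noteq> 0"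
  proof -
    show "?q - 1 \<noteq> 0" using \<open>m > 0\<close> by (simp add: q)
    moreover show "?q + 1 \<noteq> 0" by (metis of_nat_Suc of_nat_eq_0_iff add.commute nat.simps(3))
    ultimately have "(?q - 1) * (?q + 1) \<noteq> 0" by simp
    then show "?q\<^sup>2 - 1 \<noteq> 0" by (simp add: power2_eq_square algebra_simps)
  qed simp
  have one: "quarter_phase ?X (\<lambda>A. 1)"
    by (rule quarter_phase_SL2[OF four, where k = "2 * int m * (int m + 1)"])
      (simp_all add: card_unipotents q power2_eq_square algebra_simps)
  have St: "quarter_phase ?X (\<lambda>A. fixed_lines A - 1)"
    by (rule quarter_phase_SL2[OF four, where k = 0])
      (simp_all add: fixed_lines_uminus sum_subtractf Lfix card_unipotents)
  \<comment> \<open>The functions \<open>e\<close>, \<open>p\<close>, \<open>fixed_lines\<close> and \<open>1\<close> span a space invariant under the class sum of the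
    unipotents. Its eigenvalues there are \<open>q\<^sup>2 - 1\<close>, \<open>0\<close>, \<open>q - 1\<close> and \<open>- (q + 1)\<close>, with eigenvectors \<open>1\<close>,
    \<open>fixed_lines - 1\<close> (the Steinberg character), \<open>?x1\<close> and \<open>?x2\<close>.\<close>
  let ?x1 = "\<lambda>A. ?q * e A + p A - 2 / (?q - 1) * fixed_lines A"
  let ?x2 = "\<lambda>A. - ?q * e A + p A + 2 / (?q + 1) * fixed_lines A - 4 / (?q + 1)"
  have x1: "quarter_phase ?X ?x1"
  proof (rule quarter_phase_SL2[OF four, where k = "int m"])
    fix A :: "'a^2^2" assume A: "det A = 1"
    have "?L ?x1 A = ?q * ?L e A + ?L p A - 2 / (?q - 1) * ?L fixed_lines A"
      by (simp add: sum.distrib sum_subtractf sum_distrib_left)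
    also have "\<dots> = ?q * (p A - e A) + (2 * (?q + 1) - 2 * fixed_lines A - p A + ?q\<^sup>2 * e A)
        - 2 / (?q - 1) * (?q\<^sup>2 - 1)"
      by (simp only: Le[OF A] Lp[OF A] Lfix[OF A])
    also have "2 / (?q - 1) * (?q\<^sup>2 - 1) = 2 * (?q + 1)"
      using nz by (simp add: field_simps power2_eq_square)
    also have "?q * (p A - e A) + (2 * (?q + 1) - 2 * fixed_lines A - p A + ?q\<^sup>2 * e A) - 2 * (?q + 1)
       = (?q - 1) * ?x1 A"
      using nz by (simp add: field_simps power2_eq_square)
    finally have L: "?L ?x1 A = (?q - 1) * ?x1 A" .
    have "2 * of_int (int m) = ?q - 1" by (simp add: q)
    then show "?L ?x1 A = 2 * of_int (int m) * ?x1 A" by (simp only: L)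
  qed (simp_all only: even fixed_lines_uminus)
  have x2: "quarter_phase ?X ?x2"
  proof (rule quarter_phase_SL2[OF four, where k = "- int m - 1"])
    fix A :: "'a^2^2" assume A: "det A = 1"
    have "?L ?x2 A = - ?q * ?L e A + ?L p A + 2 / (?q + 1) * ?L fixed_lines A - (?q\<^sup>2 - 1) * (4 / (?q + 1))"
      by (simp add: sum.distrib sum_subtractf sum_distrib_left sum_negf card_unipotents)
    also have "\<dots> = - ?q * (p A - e A) + (2 * (?q + 1) - 2 * fixed_lines A - p A + ?q\<^sup>2 * e A)
        + 2 / (?q + 1) * (?q\<^sup>2 - 1) - (?q\<^sup>2 - 1) * (4 / (?q + 1))"
      by (simp only: Le[OF A] Lp[OF A] Lfix[OF A])
    also have "2 / (?q + 1) * (?q\<^sup>2 - 1) = 2 * (?q - 1)"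
      using nz by (simp add: field_simps power2_eq_square)
    also have "(?q\<^sup>2 - 1) * (4 / (?q + 1)) = 4 * (?q - 1)"
      using nz by (simp add: field_simps power2_eq_square)
    also have "- ?q * (p A - e A) + (2 * (?q + 1) - 2 * fixed_lines A - p A + ?q\<^sup>2 * e A)
        + 2 * (?q - 1) - 4 * (?q - 1) = - (?q + 1) * ?x2 A"
    proof -
      \<comment> \<open>\<open>r\<close> stands for \<open>2 / (?q + 1)\<close>; keeping only
        \<open>(a + 1) * r = 2\<close> makes the identity polynomial.\<close>
      have *: "- a * (y - x) + (2 * (a + 1) - 2 * F - y + a\<^sup>2 * x) + 2 * (a - 1) - 4 * (a - 1)
          = - (a + 1) * (- a * x + y + r * F - 2 * r)" if "(a + 1) * r = 2" for a x y F r :: complex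
      proof -
        have "- (a + 1) * (- a * x + y + r * F - 2 * r)
            = (a + 1) * (a * x - y) - ((a + 1) * r) * F + 2 * ((a + 1) * r)"
          by (simp add: algebra_simps)
        then show ?thesis unfolding that by (simp add: algebra_simps power2_eq_square)
      qed
      have "(?q + 1) * (2 / (?q + 1)) = 2"
        using nz(2) by (metis nonzero_mult_div_cancel_left times_divide_eq_right)
      from *[OF this] show ?thesis by simp
    qed
    finally have L: "?L ?x2 A = - (?q + 1) * ?x2 A" .
    have "2 * of_int (- int m - 1) = - (?q + 1)" by (simp add: q)
    then show "?L ?x2 A = 2 * of_int (- int m - 1) * ?x2 A" by (simp only: L)
  qed (simp_all only: even fixed_lines_uminus)
  \<comment> \<open>In \<open>?x1 - ?x2\<close> the function \<open>p\<close> cancels and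
    \<open>2 q e\<close> remains, up to a multiple of \<open>fixed_lines\<close> and a constant; the
    last two summands remove those.\<close>
  have "quarter_phase ?X (\<lambda>A. 1 / (2 * ?q) * (?x1 A + ((- 1) * ?x2 A +
      (4 * ?q / (?q\<^sup>2 - 1) * (fixed_lines A - 1) + (4 * ?q / (?q\<^sup>2 - 1) - 4 / (?q + 1)) * 1))))"
    by (rule quarter_phase_cmult[OF quarter_phase_add[OF x1 quarter_phase_add[OF quarter_phase_cmult[OF x2]
          quarter_phase_add[OF quarter_phase_cmult[OF St] quarter_phase_cmult[OF one]]]]])
  then show ?thesis
  proof (rule quarter_phase_cong)
    fix A :: "'a^2^2"
    have d: "4 * ?q / (?q\<^sup>2 - 1) = 2 / (?q - 1) + 2 / (?q + 1)"
      using nz by (simp add: field_simps power2_eq_square)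
    have "1 / (2 * ?q) * (?x1 A + ((- 1) * ?x2 A +
      (4 * ?q / (?q\<^sup>2 - 1) * (fixed_lines A - 1) + (4 * ?q / (?q\<^sup>2 - 1) - 4 / (?q + 1)) * 1)))
      = 1 / (2 * ?q) * (2 * ?q * e A)"
    proof -
      have "(a * x + y - u * F) + ((- 1) * (- a * x + y + w * F - 2 * w) + ((u + w) * (F - 1) + ((u + w) - 2 * w) * 1))
          = 2 * a * x" for a x y F u w :: complex
        by (simp add: algebra_simps)
      from this[of ?q "e A" "p A" "2 / (?q - 1)" "fixed_lines A" "2 / (?q + 1)"]
      show ?thesis unfolding d by simp
    qed
    also have "\<dots> = e A" using nz by simp
    also have "- A = mat 1 \<longleftrightarrow> A = - mat 1" by (metis minus_minus)
    then have "e A = of_bool (A = mat 1) + of_bool (A = - mat 1)" by (simp add: e_def)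
    finally show "1 / (2 * ?q) * (?x1 A + ((- 1) * ?x2 A +
      (4 * ?q / (?q\<^sup>2 - 1) * (fixed_lines A - 1) + (4 * ?q / (?q\<^sup>2 - 1) - 4 / (?q + 1)) * 1)))
      = of_bool (A = mat 1) + of_bool (A = - mat 1)" .
  qed
qed

section \<open>Connection set of SL(2,q): generation, conjugation, inversion\<close>

lemma generate_transvections:
  fixes S :: "('a::field^2^2) set"
  assumes S: "unipotents \<subseteq> S" "S \<subseteq> carrier SL2"
  shows "generate SL2 S = carrier SL2"
proof (intro equalityI subsetI)
  interpret group "SL2 :: ('a^2^2) monoid" by (rule group_SL2)
  show "A \<in> carrier SL2" if "A \<in> generate SL2 S" for A
    using generate_in_carrier[OF S(2) that] .
  have mult: "A ** B \<in> generate SL2 S" if "A \<in> generate SL2 S" "B \<in> generate SL2 S" for A B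
    using generate.eng[OF that] by (simp add: SL2_simps)
  have unip: "A \<in> generate SL2 S" if "det A = 1" "trace A = 2" for A
    using that S(1) generate.incl[of A S SL2] generate.one[of SL2 S]
    by (cases "A = mat 1") (auto simp: unipotents_def SL2_simps)
  have upper: "mat2 1 x 0 1 \<in> generate SL2 S" and lower: "mat2 1 0 x 1 \<in> generate SL2 S" for x
    by (auto intro!: unip simp: det_2 trace_2)
  have nonzero: "A \<in> generate SL2 S" if A: "det A = 1" and c: "A $ 2 $ 1 \<noteq> 0" for A
  proof -
    \<comment> \<open>Chosen so that the product upper, lower, upper triangular has the diagonal of
      \<open>A\<close>; the entry (1,2) then agrees because both determinants are 1.\<close>
    define x y where "x = (A $ 1 $ 1 - 1) / A $ 2 $ 1" and "y = (A $ 2 $ 2 - 1) / A $ 2 $ 1"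
    have "x * A $ 2 $ 1 = A $ 1 $ 1 - 1" "A $ 2 $ 1 * y = A $ 2 $ 2 - 1"
      using c by (simp_all add: x_def y_def)
    moreover have "A $ 1 $ 2 = y + x * A $ 2 $ 2"
      using A c by (simp add: x_def y_def det_2 field_simps)
    ultimately have "A = mat2 1 x 0 1 ** (mat2 1 0 (A $ 2 $ 1) 1 ** mat2 1 y 0 1)"
      by (simp add: mat2_simps)
    then show ?thesis using mult upper lower by metis
  qed
  fix A :: "'a^2^2" assume "A \<in> carrier SL2"
  then have A: "det A = 1" by (simp add: SL2_simps)
  show "A \<in> generate SL2 S"
  proof (cases "A $ 2 $ 1 = 0")
    case True
    then have "A $ 1 $ 1 \<noteq> 0" using A by (auto simp: det_2)
    \<comment> \<open>Adding the first row to the second puts \<open>A $ 1 $ 1\<close>, which is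
      nonzero, into the lower left corner.\<close>
    then have "mat2 1 0 1 1 ** A \<in> generate SL2 S"
      using A True by (intro nonzero) (simp_all add: det_mul det_2[of "mat2 _ _ _ _"] matrix_mult_nth_2)
    moreover have "A = mat2 1 0 (- 1) 1 ** (mat2 1 0 1 1 ** A)" by (simp add: mat2_simps)
    ultimately show ?thesis using mult lower by metis
  qed (use A nonzero in blast)
qed

lemma trace_conjugate:
  fixes A B C :: "'a::comm_ring_1^2^2"
  assumes "C ** A = mat 1"
  shows "trace (A ** B ** C) = trace B"
  by (metis assms matrix_mul_assoc matrix_mul_lid trace_mul_sym)

text \<open>In this form stability under conjugation and inversion can be read off from determinant
  and trace.\<close>

lemma pm_unipotents_iff:
  "A \<in> pm_unipotents \<longleftrightarrow> det A = 1 \<and> (trace A = 2 \<and> A \<noteq> mat 1 \<or> trace A = - 2 \<and> A \<noteq> - mat 1)"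
proof -
  have "A \<in> uminus ` unipotents \<longleftrightarrow> - A \<in> unipotents" by (metis (no_types) image_iff minus_minus)
  moreover have "- A = mat 1 \<longleftrightarrow> A = - mat 1" "- trace A = 2 \<longleftrightarrow> trace A = - 2"
    by (metis minus_minus)+
  ultimately show ?thesis
    by (auto simp: pm_unipotents_def unipotents_def det_uminus_2 trace_uminus_2)
qed

lemma PST_connection_set_SL2:
  assumes four: "(4 :: 'a::{field,finite}) \<noteq> 0" and odd: "odd CARD('a)"
  shows "PST_connection_set SL2 (insert (- mat 1) pm_unipotents :: ('a^2^2) set)" (is "PST_connection_set _ ?S")
proof -
  interpret group "SL2 :: ('a^2^2) monoid" by (rule group_SL2)
  have ne: "(2 :: 'a) \<noteq> 0" "(2 :: 'a) \<noteq> - 2"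
  proof -
    show "(2 :: 'a) \<noteq> - 2" using four by (simp add: eq_neg_iff_add_eq_0)
    then show "(2 :: 'a) \<noteq> 0" by (metis neg_0_equal_iff_equal)
  qed
  have m1: "- mat 1 \<noteq> (mat 1 :: 'a^2^2)" using ne by (auto simp: mat_eq_iff_2 neg_eq_iff_add_eq_0)
  have S: "?S \<subseteq> carrier SL2 - {\<one>\<^bsub>SL2\<^esub>}"
    using m1 ne by (auto simp: pm_unipotents_iff SL2_simps det_uminus_2 trace_2)
  have inv_SL2: "inv\<^bsub>SL2\<^esub> A ** A = mat 1" "det (inv\<^bsub>SL2\<^esub> A) = 1" if "A \<in> carrier SL2" for A :: "'a^2^2"
    using l_inv[OF that] inv_closed[OF that] by (simp_all add: SL2_simps)
  have conj: "g \<otimes>\<^bsub>SL2\<^esub> s \<otimes>\<^bsub>SL2\<^esub> inv\<^bsub>SL2\<^esub> g \<in> ?S" if g: "g \<in> carrier SL2" and s: "s \<in> ?S" for g s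
  proof -
    let ?t = "g ** s ** inv\<^bsub>SL2\<^esub> g"
    have sG: "s \<in> carrier SL2" using s S by blast
    have eq: "?t = c \<longleftrightarrow> s = c" if "c ** g = g ** c" "c \<in> carrier SL2" for c
    proof -
      have "?t = c \<longleftrightarrow> g ** s = c ** g"
        using inv_solve_right'[of c "g ** s" g] g sG that(2) by (simp add: SL2_simps det_mul)
      also have "\<dots> \<longleftrightarrow> s = c"
        using Units_l_cancel[of g s c] g sG that by (simp add: SL2_simps)
      finally show ?thesis .
    qed
    have "?t = mat 1 \<longleftrightarrow> s = mat 1" "?t = - mat 1 \<longleftrightarrow> s = - mat 1"
      by (intro eq; simp add: matrix_mult_uminus_left matrix_mult_uminus_right SL2_simps det_uminus_2)+
    moreover have "det ?t = det s" using g inv_SL2(2)[OF g] by (simp add: det_mul SL2_simps)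
    moreover have "trace ?t = trace s" using inv_SL2(1)[OF g] by (rule trace_conjugate)
    ultimately show ?thesis using s by (simp add: pm_unipotents_iff SL2_simps)
  qed
  have inv: "inverse_closed SL2 ?S"
    unfolding inverse_closed_def
  proof
    fix s assume s: "s \<in> ?S"
    then have sG: "s \<in> carrier SL2" using S by blast
    have "inv\<^bsub>SL2\<^esub> s = mat2 (s$2$2) (- s$1$2) (- s$2$1) (s$1$1)"
      by (rule inv_equality) (use sG in \<open>simp_all add: SL2_simps mat2_simps algebra_simps\<close>)
    then show "inv\<^bsub>SL2\<^esub> s \<in> ?S" using s
      by (auto simp: pm_unipotents_iff mat2_simps algebra_simps)
  qed
  \<comment> \<open>Its trace 0 differs from 2 and -2, so \<open>?J\<close> and \<open>- ?J\<close>
    avoid the connection set and serve as the two neighbours of the identity in the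
    complement.\<close>
  let ?J = "mat2 0 1 (- 1) 0 :: 'a^2^2"
  have "Digraph_Component.connected (with_proj (Cayley_graph SL2 ?S))"
    using S inv by (intro connected_Cayley_graph generate_transvections) (auto simp: pm_unipotents_def)
  moreover have "union_of_conjugacy_classes SL2 ?S"
    using S conj by (intro union_of_conjugacy_classesI) auto
  moreover have "admits_PST (Cayley_graph SL2 ?S)"
  proof (rule admits_PST_Cayley_graph)
    show "quarter_phase (Cayley_graph SL2 ?S) (\<lambda>u. std_basis \<one>\<^bsub>SL2\<^esub> u + std_basis (- mat 1) u)"
      by (rule quarter_phase_cong[OF quarter_phase_SL2_center[OF four odd]])
        (simp add: SL2_simps std_basis_def)
    show "- mat 1 \<otimes>\<^bsub>SL2\<^esub> s \<in> pm_unipotents" if "s \<in> pm_unipotents" for s :: "'a^2^2"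
      using that by (auto simp: pm_unipotents_def SL2_simps matrix_mult_uminus_left)
  qed (use S m1 ne in \<open>auto simp: SL2_simps matrix_mult_uminus_left pm_unipotents_iff trace_2\<close>)
  moreover have "\<not> disjoint_union_of_K2 (graph_complement (Cayley_graph SL2 ?S))"
    by (rule not_disjoint_union_of_K2_complement_Cayley_graph[of ?J "- ?J"])
      (use ne in \<open>auto simp: SL2_simps det_2 trace_2 pm_unipotents_iff mat_eq_iff_2 eq_neg_iff_add_eq_0\<close>)
  ultimately show ?thesis using S inv by (simp add: PST_connection_set_def)
qed

section \<open>The general linear and unitary groups\<close>

text \<open>Stated for a bare carrier so that \<open>GL2\<close> and \<open>GU2 B\<close> are both
  instances. \<open>J\<close> supplies \<open>z = - mat 1\<close> as its square, and
  \<open>R\<close> makes the kernel of the determinant a proper subgroup, so that its complement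
  generates.\<close>

lemma ex_PST_connection_set_linear_group:
  fixes C :: "('a::{field,finite}^2^2) set"
  defines "G \<equiv> \<lparr>carrier = C, mult = (**), one = mat 1\<rparr>"
  assumes grp: "group G" and two: "(1 :: 'a) \<noteq> - 1"
    and J: "J \<in> C" "det J = 1" "J ** J = - mat 1" and R: "R \<in> C" "det R \<noteq> 1"
  shows "\<exists>S. PST_connection_set G S"
proof -
  interpret group G by (rule grp)
  have G: "carrier G = C" "mult G = (**)" "one G = mat 1" by (simp_all add: G_def)
  define N where "N = {A \<in> C. det A = 1}"
  have mult: "A ** B \<in> C" if "A \<in> C" "B \<in> C" for A B
    using m_closed[of A B] that by (simp add: G)
  have det_inv: "det (inv\<^bsub>G\<^esub> A) * det A = 1" if "A \<in> C" for A
    using l_inv[of A] that by (simp add: G flip: det_mul)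
  have sub: "subgroup N G"
  proof
    show "inv\<^bsub>G\<^esub> A \<in> N" if "A \<in> N" for A
      using that det_inv[of A] inv_closed[of A] by (simp add: N_def G)
  qed (use one_closed in \<open>auto simp: N_def G mult det_mul\<close>)
  have "N \<lhd> G"
    unfolding normal_inv_iff
  proof (intro conjI ballI sub)
    fix g h assume g: "g \<in> carrier G" and h: "h \<in> N"
    have "g \<otimes>\<^bsub>G\<^esub> h \<otimes>\<^bsub>G\<^esub> inv\<^bsub>G\<^esub> g \<in> C"
      using g h inv_closed[of g] by (simp add: N_def G mult)
    moreover have "det (g \<otimes>\<^bsub>G\<^esub> h \<otimes>\<^bsub>G\<^esub> inv\<^bsub>G\<^esub> g) = det (inv\<^bsub>G\<^esub> g) * det g"
      using h by (simp add: G det_mul N_def)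
    ultimately show "g \<otimes>\<^bsub>G\<^esub> h \<otimes>\<^bsub>G\<^esub> inv\<^bsub>G\<^esub> g \<in> N"
      using g det_inv[of g] by (simp add: N_def G)
  qed
  moreover have "N \<noteq> carrier G" using R by (auto simp: N_def G)
  moreover have m1: "- mat 1 \<noteq> (mat 1 :: 'a^2^2)"
    using two by (metis mat_1_nth_2(1) vector_uminus_component)
  moreover have "- mat 1 \<in> N" using mult[OF J(1,1)] J by (simp add: N_def det_uminus_2)
  moreover have "4 dvd card N"
  proof -
    interpret N: group "G\<lparr>carrier := N\<rparr>" by (rule subgroup_imp_group[OF sub])
    have JN: "J \<in> carrier (G\<lparr>carrier := N\<rparr>)" using J by (simp add: N_def)
    have J2: "J [^]\<^bsub>G\<lparr>carrier := N\<rparr>\<^esub> (2::nat) = - mat 1"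
      using J by (simp add: numeral_2_eq_2 G)
    then have J4: "J [^]\<^bsub>G\<lparr>carrier := N\<rparr>\<^esub> (2 + 2::nat) = mat 1"
      unfolding N.nat_pow_mult[OF JN, symmetric]
      by (simp add: G matrix_mult_uminus_left)
    have "N.ord J dvd 4" using J4 N.pow_eq_id[OF JN, of 4] by (simp add: G)
    moreover have "\<not> N.ord J dvd 2"
    proof
      assume "N.ord J dvd 2"
      then have "J [^]\<^bsub>G\<lparr>carrier := N\<rparr>\<^esub> (2::nat) = mat 1"
        using N.pow_eq_id[OF JN, of 2] by (simp add: G)
      then show False using J2 m1 by (simp only:)
    qed
    moreover have "x \<in> {1, 2, 4}" if "x dvd 4" for x :: nat
    proof -
      have "x \<le> 4" using that by (simp add: dvd_imp_le)
      then have "x \<in> {0, 1, 2, 3, 4}" by auto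
      then show ?thesis using that by auto
    qed
    ultimately have "N.ord J = 4" by (metis insertE singletonD one_dvd dvd_refl)
    then show ?thesis using N.ord_dvd_group_order[OF JN] by (simp add: order_def)
  qed
  ultimately have "PST_connection_set G (insert (- mat 1) (carrier G - N))"
    by (intro PST_connection_set_complement_of_normal_subgroup)
      (simp_all add: G matrix_mult_uminus_left matrix_mult_uminus_right)
  then show ?thesis ..
qed

section \<open>Finite fields: power maps, norms and the characteristic\<close>

lemma card_power_eq_le:
  fixes a :: "'a::idom"
  assumes "n > 0"
  shows "card {x. x ^ n = a} \<le> n"
proof -
  let ?p = "Polynomial.monom 1 n + [:- a:]"
  have deg: "degree ?p = n"
    using assms by (simp add: degree_add_eq_left degree_monom_eq)
  then have "?p \<noteq> 0" using assms by auto
  then have "card {x. poly ?p x = 0} \<le> degree ?p" by (rule card_poly_roots_bound)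
  then show ?thesis by (simp add: deg poly_monom)
qed

text \<open>Multiplication by \<open>x\<close> permutes the nonzero elements; compare their
  products.\<close>

lemma power_card_minus_1_eq_1:
  fixes x :: "'a::{field,finite}"
  assumes "x \<noteq> 0"
  shows "x ^ (CARD('a) - 1) = 1"
proof -
  have "(\<Prod>y\<in>UNIV - {0}. y) = (\<Prod>y\<in>UNIV - {0}. x * y)"
    by (rule prod.reindex_bij_witness[of _ "\<lambda>y. x * y" "\<lambda>y. y / x"]) (use assms in auto)
  also have "\<dots> = x ^ (CARD('a) - 1) * (\<Prod>y\<in>UNIV - {0}. y)"
    by (simp add: prod.distrib)
  finally show ?thesis by simp
qed

text \<open>The norm \<open>c ^ (q + 1)\<close> sends the \<open>(q + 1) (q - 1)\<close> nonzero
  elements into the roots of \<open>x ^ (q - 1) = 1\<close>. Its fibres have at most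
  \<open>q + 1\<close> elements and there are at most \<open>q - 1\<close> such roots, so every root
  is attained; \<open>a\<close> is one of them.\<close>

lemma norm_surjective:
  fixes a :: "'a::{field,finite}"
  assumes card: "CARD('a) = q\<^sup>2" and q: "q > 1" and a: "a \<noteq> 0" "a ^ q = a"
  obtains c where "c ^ (q + 1) = a"
proof -
  let ?F = "UNIV - {0 :: 'a}" and ?f = "\<lambda>c :: 'a. c ^ (q + 1)"
  let ?R = "{x :: 'a. x ^ (q - 1) = 1}"
  have q2: "q\<^sup>2 - 1 = (q + 1) * (q - 1)"
    using q by (cases q) (simp_all add: power2_eq_square)
  have "?f c ^ (q - 1) = 1" if "c \<noteq> 0" for c
    using power_card_minus_1_eq_1[OF that] by (simp only: card q2 power_mult)
  then have sub: "?f ` ?F \<subseteq> ?R" by blast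
  have "card ?F = q\<^sup>2 - 1" by (simp add: card)
  then have "(q + 1) * (q - 1) = card ?F" by (simp only: q2)
  also have "?F = (\<Union>y\<in>?f ` ?F. {c \<in> ?F. ?f c = y})" by blast
  also have "card \<dots> \<le> (\<Sum>y\<in>?f ` ?F. card {c \<in> ?F. ?f c = y})"
    by (rule card_UN_le) simp
  also have "\<dots> \<le> (\<Sum>y\<in>?f ` ?F. q + 1)"
  proof (rule sum_mono)
    fix y
    have "card {c \<in> ?F. ?f c = y} \<le> card {c. ?f c = y}" by (rule card_mono) auto
    also have "\<dots> \<le> q + 1" by (rule card_power_eq_le) simp
    finally show "card {c \<in> ?F. ?f c = y} \<le> q + 1" .
  qed
  also have "\<dots> = (q + 1) * card (?f ` ?F)" by simp
  finally have "q - 1 \<le> card (?f ` ?F)" by (rule mult_left_le_imp_le) simp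
  moreover have "card ?R \<le> q - 1" using q by (intro card_power_eq_le) simp
  ultimately have "?f ` ?F = ?R" using sub by (intro card_seteq) simp_all
  moreover have "a \<in> ?R"
  proof -
    have "a ^ (q - 1) * a = a ^ q" using q by (simp flip: power_Suc2)
    then show ?thesis using a by simp
  qed
  ultimately have "a \<in> ?f ` ?F" by simp
  then show ?thesis using that by blast
qed

text \<open>The characteristic divides \<open>q^2\<close>, so \<open>q\<close> is one of its powers
  and \<open>x ^ q\<close> is an iterate of the Frobenius map.\<close>

lemma power_primepow_add:
  fixes x y :: "'a::{field,finite}"
  assumes "primepow q" "CARD('a) = q\<^sup>2"
  shows "(x + y) ^ q = x ^ q + y ^ q"
proof -
  obtain p k where p: "prime p" "k > 0" "q = p ^ k" using assms(1) by (auto simp: primepow_def)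
  have prime: "prime CHAR('a)"
    by (rule prime_CHAR_semidom) (simp add: finite_imp_CHAR_pos)
  have "CHAR('a) dvd p ^ (k * 2)"
    using CHAR_dvd_CARD[where 'a = 'a] by (simp add: assms(2) p(3) power_mult)
  then have "CHAR('a) = p"
    using prime p(1) by (metis prime_dvd_power primes_dvd_imp_eq)
  then show ?thesis using prime p(3) by (intro freshmans_dream') simp_all
qed

lemma four_neq_0_if_odd_card:
  assumes "odd CARD('a::{field,finite})"
  shows "(4 :: 'a) \<noteq> 0"
proof
  assume "(4 :: 'a) = 0"
  then have "of_nat 4 = (0 :: 'a)" by simp
  then have "CHAR('a) dvd 2 ^ 2" by (simp only: of_nat_eq_0_iff_char_dvd) simp
  moreover have prime: "prime CHAR('a)"
    by (rule prime_CHAR_semidom) (simp add: finite_imp_CHAR_pos)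
  ultimately have "CHAR('a) = 2" by (metis prime_dvd_power primes_dvd_imp_eq two_is_prime_nat)
  then show False using CHAR_dvd_CARD[where 'a = 'a] assms by simp
qed

lemma one_neq_uminus_one:
  assumes "(4 :: 'a::field) \<noteq> 0"
  shows "(1 :: 'a) \<noteq> - 1"
proof
  assume "(1 :: 'a) = - 1"
  then have "(1 :: 'a) + 1 = 0" by (simp only: eq_neg_iff_add_eq_0)
  moreover have "(4 :: 'a) = (1 + 1) * (1 + 1)" by simp
  ultimately show False using assms by (metis mult_zero_left)
qed

section \<open>Hermitian planes over a field with \<open>q^2\<close> elements\<close>

locale hermitian =
  fixes q :: nat and B :: "'a::{field,finite}^2 \<Rightarrow> 'a^2 \<Rightarrow> 'a"
  assumes q: "primepow q" "odd q" and card: "CARD('a) = q\<^sup>2"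
    and herm: "hermitian_form q B" and nondeg: "nondegenerate_form B"
begin

lemma q_gt_1: "q > 1"
  using q(1) unfolding primepow_def by (metis one_less_power prime_gt_1_nat)

lemma add_left: "B (u + v) w = B u w + B v w"
  and scale_left: "B (c *s u) v = c * B u v"
  and conjugate: "B v u = B u v ^ q"
  using herm unfolding hermitian_form_def by blast+

lemma add_right: "B u (v + w) = B u v + B u w"
  by (metis add_left conjugate power_primepow_add[OF q(1) card])

lemma scale_right: "B u (c *s v) = c ^ q * B u v"
  by (simp only: conjugate[of u "c *s v"] conjugate[of u v] scale_left power_mult_distrib)

text \<open>If all vectors were isotropic, expanding \<open>B\<close> at \<open>c *s u + w\<close>
  would give \<open>B u w ^ q = - B u w\<close> for \<open>c = 1\<close>, and then
  \<open>c ^ q = c\<close> for all \<open>c\<close>. But at most \<open>q - 1\<close> nonzero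
  elements satisfy this, out of \<open>q^2 - 1\<close>.\<close>

lemma ex_anisotropic: "\<exists>v. B v v \<noteq> 0"
proof (rule ccontr)
  assume "\<nexists>v. B v v \<noteq> 0"
  then have iso: "B v v = 0" for v by blast
  have "vector [1, 0] \<noteq> (0 :: 'a^2)" by (simp add: vec_eq_iff_2)
  then obtain u w where uw: "B u w \<noteq> 0" using nondeg unfolding nondegenerate_form_def by blast
  have anti: "c * B u w + c ^ q * B u w ^ q = 0" for c
  proof -
    have "B (c *s u + w) (c *s u + w) = 0" by (rule iso)
    then show ?thesis
      by (simp add: add_left add_right scale_left scale_right iso[of u] iso[of w] conjugate[of w u]
        add.commute)
  qed
  have Bq: "B u w ^ q = - B u w" using anti[of 1] by (simp add: eq_neg_iff_add_eq_0 add.commute)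
  have fixed: "c ^ q = c" for c :: 'a
  proof -
    have "c * B u w + c ^ q * - B u w = 0" using anti[of c] by (simp only: Bq)
    then have "(c - c ^ q) * B u w = 0" by (simp add: algebra_simps)
    then show ?thesis using uw by simp
  qed
  have "c ^ (q - 1) = 1" if "c \<noteq> 0" for c :: 'a
  proof -
    have "c ^ (q - 1) * c = c ^ q" using q_gt_1 by (simp flip: power_Suc2)
    then show ?thesis using that fixed by simp
  qed
  then have "UNIV - {0 :: 'a} \<subseteq> {c. c ^ (q - 1) = 1}" by blast
  then have "card (UNIV - {0 :: 'a}) \<le> card {c :: 'a. c ^ (q - 1) = 1}" by (intro card_mono) simp_all
  also have "\<dots> \<le> q - 1" using q_gt_1 by (intro card_power_eq_le) simp
  finally have "q\<^sup>2 - 1 \<le> q - 1" by (simp add: card)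
  moreover have "q < q\<^sup>2" using q_gt_1 by (simp add: power2_eq_square)
  ultimately show False using q_gt_1 by linarith
qed

text \<open>Gram-Schmidt from an anisotropic \<open>v\<close>: if \<open>B w w\<close> vanished,
  \<open>w\<close> would be orthogonal to everything, against nondegeneracy. The diagonal values are
  fixed by the power \<open>q\<close> by hermitian symmetry.\<close>

lemma ex_orthogonal_basis:
  obtains W a b where "det W \<noteq> 0" "a \<noteq> 0" "b \<noteq> 0" "a ^ q = a" "b ^ q = b"
    "\<And>x y. B (W *v x) (W *v y) = a * x $ 1 * (y $ 1) ^ q + b * x $ 2 * (y $ 2) ^ q"
proof -
  obtain v where v: "B v v \<noteq> 0" using ex_anisotropic by blast
  have "B 0 w = 0" for w using scale_left[of 0 0 w] by simp
  then have "v \<noteq> 0" using v by auto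
  moreover have "symp v (vector [0, 1]) = v $ 1" "symp v (vector [1, 0]) = - v $ 2"
    by (simp_all add: symp_def)
  ultimately obtain u where u: "symp v u \<noteq> 0"
    by (metis neg_equal_0_iff_equal vec_eq_iff_2 zero_index)
  define w where "w = u + (- B u v / B v v) *s v"
  have wv: "B w v = 0" unfolding w_def add_left scale_left using v by simp
  have vw: "B v w = 0" using conjugate[of w v] conjugate[of v w] wv q_gt_1 by simp
  have symp: "symp v w = symp v u" unfolding w_def symp_add_scale_right by simp
  define W where "W = mat2 (v $ 1) (w $ 1) (v $ 2) (w $ 2)"
  have W: "W *v x = x $ 1 *s v + x $ 2 *s w" for x
    by (simp add: W_def vec_eq_iff_2 matrix_vector_mult_nth_2 mult.commute)
  have det: "det W \<noteq> 0" using u symp by (simp add: W_def det_2 symp_def mult.commute)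
  have BW: "B (W *v x) (W *v y) = B v v * x $ 1 * (y $ 1) ^ q + B w w * x $ 2 * (y $ 2) ^ q" for x y
    by (simp add: W add_left add_right scale_left scale_right vw wv)
  have "B w w \<noteq> 0"
  proof
    assume "B w w = 0"
    obtain W' where W': "W ** W' = mat 1" using det by (auto simp: invertible_def simp flip: invertible_det_nz)
    have "B w y = 0" for y
    proof -
      have "y = W *v (W' *v y)" by (simp add: matrix_vector_mul_assoc W')
      then have "B w y = B w (W *v (W' *v y))" by simp
      also have "\<dots> = 0" by (simp add: W[of "W' *v y"] add_right scale_right wv \<open>B w w = 0\<close>)
      finally show ?thesis .
    qed
    then have "w = 0" using nondeg by (simp add: nondegenerate_form_def)
    then show False using u symp by (simp add: symp_def)
  qed
  then show ?thesis using that[OF det v _ _ _ BW] conjugate[of v v] conjugate[of w w] by simp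
qed

text \<open>The columns of \<open>W\<close> form an orthogonal basis, so the required isometries are
  written in diagonal coordinates and conjugated by \<open>W\<close>, which preserves determinants
  and the relation \<open>J^2 = -1\<close>.\<close>

lemma ex_PST_connection_set_GU2: "\<exists>S. PST_connection_set (GU2 B) S"
proof -
  obtain W a b where W: "det W \<noteq> 0" and ab: "a \<noteq> 0" "b \<noteq> 0" "a ^ q = a" "b ^ q = b"
    and BW: "\<And>x y. B (W *v x) (W *v y) = a * x $ 1 * (y $ 1) ^ q + b * x $ 2 * (y $ 2) ^ q"
    by (rule ex_orthogonal_basis) blast
  obtain W' where W': "W ** W' = mat 1" "W' ** W = mat 1"
    using W by (auto simp: invertible_def simp flip: invertible_det_nz)
  have det_W': "det W' * det W = 1" by (simp add: W' flip: det_mul)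
  let ?C = "{A. invertible A \<and> (\<forall>u v. B (A *v u) (A *v v) = B u v)}"
  have det: "det (W ** M ** W') = det M" for M
    using det_W' by (simp add: det_mul mult.commute mult.left_commute[of "det M"])
  have mem: "W ** M ** W' \<in> ?C"
    if "det M \<noteq> 0" and "\<And>x y. B (W *v (M *v x)) (W *v (M *v y)) = B (W *v x) (W *v y)" for M
  proof -
    have "B ((W ** M ** W') *v u) ((W ** M ** W') *v v) = B u v" for u v
      using that(2)[of "W' *v u" "W' *v v"] by (simp add: matrix_vector_mul_assoc W' matrix_mul_assoc)
    then show ?thesis using that(1) det[of M] by (simp add: invertible_det_nz)
  qed
  have minus: "(- x) ^ q = - (x ^ q)" for x :: 'a using q(2) by simp
  have "(a / b) ^ q = a / b" using ab by (simp add: power_divide)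
  \<comment> \<open>\<open>?J\<close> exchanges the axes with factors \<open>c\<close> and
    \<open>- 1 / c\<close>; it preserves the form exactly when \<open>b * c ^ (q + 1) = a\<close>,
    and its determinant is 1 for any nonzero \<open>c\<close>.\<close>
  then obtain c where c: "c ^ (q + 1) = a / b"
    using norm_surjective[OF card q_gt_1, of "a / b"] ab by auto
  then have c0: "c \<noteq> 0" using ab by auto
  have cq: "c * c ^ q = a / b" using c by simp
  let ?J = "mat2 0 (- 1 / c) c 0"
  let ?R = "mat2 1 0 0 (- 1) :: 'a^2^2"
  have J: "W ** ?J ** W' \<in> ?C"
  proof (rule mem)
    fix x y
    have "B (W *v (?J *v x)) (W *v (?J *v y))
        = a * x $ 2 * (y $ 2) ^ q / (c * c ^ q) + b * (c * c ^ q) * x $ 1 * (y $ 1) ^ q"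
      by (simp add: BW matrix_vector_mult_nth_2 minus power_divide power_mult_distrib)
    also have "\<dots> = B (W *v x) (W *v y)" using ab by (simp add: cq BW)
    finally show "B (W *v (?J *v x)) (W *v (?J *v y)) = B (W *v x) (W *v y)" .
  qed (use c0 in \<open>simp add: det_2\<close>)
  have R: "W ** ?R ** W' \<in> ?C"
    by (rule mem) (simp_all add: BW matrix_vector_mult_nth_2 minus det_2)
  have JJ: "(W ** ?J ** W') ** (W ** ?J ** W') = - mat 1"
  proof -
    have J2: "?J ** ?J = - mat 1" using c0 by (simp add: mat2_simps)
    have "(W ** ?J ** W') ** (W ** ?J ** W') = W ** (?J ** (W' ** W) ** ?J) ** W'"
      by (simp add: matrix_mul_assoc)
    also have "\<dots> = - mat 1"
      by (simp only: W' J2 matrix_mul_rid matrix_mult_uminus_left matrix_mult_uminus_right)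
    finally show ?thesis .
  qed
  have dets: "det (W ** ?J ** W') = 1" "det (W ** ?R ** W') = - 1"
    unfolding det using c0 by (simp_all add: det_2)
  have two: "(1 :: 'a) \<noteq> - 1"
    using four_neq_0_if_odd_card[where 'a = 'a] q(2) by (intro one_neq_uminus_one) (simp add: card)
  show ?thesis
    using ex_PST_connection_set_linear_group[OF _ two J dets(1) JJ R] group_GU2[of B] two
    unfolding GU2_def dets by metis
qed

end

lemma ex_PST_connection_set_GL2:
  assumes "odd CARD('a::{field,finite})"
  shows "\<exists>S. PST_connection_set (GL2 :: ('a^2^2) monoid) S"
proof -
  let ?J = "mat2 0 1 (- 1) 0 :: 'a^2^2" and ?R = "mat2 1 0 0 (- 1) :: 'a^2^2"
  have two: "(1 :: 'a) \<noteq> - 1"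
    using assms by (intro one_neq_uminus_one four_neq_0_if_odd_card)
  have "?J ** ?J = - mat 1" by (simp add: mat2_simps)
  then show ?thesis
    using ex_PST_connection_set_linear_group[of "{A. invertible A}" ?J ?R] two group_GL2[where 'a = 'a]
    by (auto simp: GL2_def invertible_det_nz det_2)
qed

theorem theorem1p2:
  fixes q :: nat
    and G :: "('a::{field,finite}^2^2) monoid"
  assumes "primepow q" and "odd q"
    and "(CARD('a) = q \<and> G = GL2) \<or>
         (CARD('a) = q\<^sup>2 \<and> (\<exists>B. hermitian_form q B \<and> nondegenerate_form B \<and> G = GU2 B)) \<or>
         (CARD('a) = q \<and> G = SL2)"
  shows "\<exists>S. S \<subseteq> carrier G - {\<one>\<^bsub>G\<^esub>} \<and> inverse_closed G S \<and>
             union_of_conjugacy_classes G S \<and>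
             Digraph_Component.connected (with_proj (Cayley_graph G S)) \<and>
             admits_PST (Cayley_graph G S) \<and>
             \<not> disjoint_union_of_K2 (graph_complement (Cayley_graph G S))"
proof -
  from assms(3) consider "CARD('a) = q" "G = GL2"
    | B where "CARD('a) = q\<^sup>2" "hermitian_form q B" "nondegenerate_form B" "G = GU2 B"
    | "CARD('a) = q" "G = SL2"
    by blast
  then have "\<exists>S. PST_connection_set G S"
  proof cases
    case 1
    then show ?thesis using ex_PST_connection_set_GL2[where 'a = 'a] assms(2) by simp
  next
    case (2 B)
    then interpret hermitian q B using assms(1,2) by unfold_locales
    show ?thesis using ex_PST_connection_set_GU2 2(4) by simp
  next
    case 3
    then have "odd CARD('a)" using assms(2) by simp
    then show ?thesis
      using PST_connection_set_SL2 four_neq_0_if_odd_card 3(2) by blast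
  qed
  then show ?thesis unfolding PST_connection_set_def .
qed

end
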